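(* Let $W=W_{B_n}$ and let $M$ be a $K$-module. The action of $x_i$ on the $\ddot{\mathfrak H}^{\mathfrak c}_W$-module $\mathbb C[y_1,\dots,y_n]\otimes M$ is realized as follows. For any polynomial $f\in\mathbb C[y_1,\dots,y_n]$ and $m\in M$, $$x_i\circ(f\otimes m)=u\sum_{k\ne i}\frac{f-f^{s_{ki}}}{y_i-y_k}\otimes(1+c_kc_i)s_{ki}m+u\sum_{k\ne i}\frac{f-f^{\overline{s}_{ki}}}{y_i+y_k}\otimes(1-c_kc_i)\overline{s}_{ki}m+\sqrt2\,v\,\frac{f-f^{\tau_i}}{2y_i}\otimes\tau_im .$$
   Context: Ground field $\mathbb C$, $u,v\in\mathbb C$. $W=W_{B_n}$ ($n\ge2$) is the group of signed permutations of $e_1,\dots,e_n$. For $i\ne j$: $s_{ij}$ swaps $e_i,e_j$; $\overline{s}_{ij}$ sends $e_i\mapsto-e_j$, $e_j\mapsto-e_i$; $\tau_i$ sends $e_i\mapsto-e_i$ (other basis vectors fixed). $\mathcal C_n$ is generated by $c_1,\dots,c_n$ with $c_i^2=1$, $c_ic_j=-c_jc_i$ ($i\ne j$); $W$ acts on the $c_i$ (by algebra automorphisms), on $\mathfrak h^*=\bigoplus\mathbb Cx_i$ and on $\mathfrak h=\bigoplus\mathbb Cy_i$ by the same signed permutations as on the $e_i$. $K=\mathcal C_n\rtimes\mathbb CW$. The rational double affine Hecke-Clifford algebra $\ddot{\mathfrak H}^{\mathfrak c}_W$ of type $B_n$ is generated by $x_i,y_i,c_i$ ($1\le i\le n$)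 and $W$, subject to the relations of $K$ and: $x_ix_j=x_jx_i$, $y_iy_j=y_jy_i$, $y_ic_j=c_jy_i$ (all $i,j$); $x_ic_i=-c_ix_i$, $x_ic_j=c_jx_i$ ($i\ne j$); $wxw^{-1}=w(x)$, $wyw^{-1}=w(y)$ ($w\in W$, $x\in\mathfrak h^*$, $y\in\mathfrak h$); $[y_j,x_i]=u\big((1+c_jc_i)s_{ij}-(1-c_jc_i)\overline{s}_{ij}\big)$ ($i\ne j$); $[y_i,x_i]=-u\sum_{k\ne i}\big((1+c_kc_i)s_{ki}+(1-c_kc_i)\overline{s}_{ki}\big)-\sqrt2\,v\tau_i$. It has the triangular decomposition $\mathbb C[x_1,\dots,x_n]\otimes K\otimes\mathbb C[y_1,\dots,y_n]$. Let $\mathfrak H_x$ be the subalgebra generated by $K$ and $x_1,\dots,x_n$. A $K$-module $M$ is extended to an $\mathfrak H_x$-module by letting all $x_i$ act by $0$, and $M_x=\mathrm{Ind}_{\mathfrak H_x}^{\ddot{\mathfrak H}^{\mathfrak c}_W}M$ is identified as a vector space with $\mathbb C[y_1,\dots,y_n]\otimes M$; this is the module structure in question ($\circ$ denotes the action; $y_i$ acts by left multiplication). $f^\sigma$ denotes the action of $\sigma\in W$ on a polynomial $f$. *)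

theory Defs
  imports Complex_Main "HOL-Algebra.Algebra" "HOL-Library.Poly_Mapping" "HOL-Library.Cardinality"
    "HOL-Combinatorics.Transposition"
begin

section \<open>Algebras given by generators and relations\<close>

text \<open>The free monoid on \<open>'g\<close>. Its monoid algebra \<open>'g free_alg\<close> (with the convolution product
  of \<^theory>\<open>HOL-Library.Poly_Mapping\<close>) is the free associative unital complex algebra.\<close>

datatype 'g word = Word "'g list"

instantiation word :: (type) monoid_add
begin

definition zero_word :: "'a word" where "0 = Word []"

fun plus_word :: "'a word \<Rightarrow> 'a word \<Rightarrow> 'a word" where
  "Word xs + Word ys = Word (xs @ ys)"

instance
proof
  fix a b c :: "'a word"
  show "a + b + c = a + (b + c)" by (cases a; cases b; cases c) simp
  show "0 + a = a" by (cases a) (simp add: zero_word_def)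
  show "a + 0 = a" by (cases a) (simp add: zero_word_def)
qed

end

type_synonym 'g free_alg = "'g word \<Rightarrow>\<^sub>0 complex"

definition gen :: "'g \<Rightarrow> 'g free_alg" where
  "gen g = Poly_Mapping.single (Word [g]) 1"

definition scal :: "complex \<Rightarrow> 'g free_alg" where
  "scal a = Poly_Mapping.single 0 a"

definition type_ring :: "'a::ring_1 ring" where
  "type_ring = \<lparr>carrier = UNIV, monoid.mult = (*), one = 1, ring.zero = 0, ring.add = (+)\<rparr>"

text \<open>\<^const>\<open>genideal\<close> yields the two-sided ideal.\<close>

definition presented :: "'g free_alg set \<Rightarrow> 'g free_alg set ring" where
  "presented R = type_ring Quot (Idl\<^bsub>type_ring\<^esub> R)"

definition cls :: "'g free_alg set \<Rightarrow> 'g free_alg \<Rightarrow> 'g free_alg set" where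
  "cls R a = (Idl\<^bsub>type_ring\<^esub> R) +>\<^bsub>type_ring\<^esub> a"


section \<open>Modules and tensor products over noncommutative rings\<close>

locale left_module = ring R for R (structure) +
  fixes act :: "'a \<Rightarrow> 'm::ab_group_add \<Rightarrow> 'm"
  assumes act_add_left: "\<lbrakk>a \<in> carrier R; b \<in> carrier R\<rbrakk> \<Longrightarrow> act (a \<oplus> b) m = act a m + act b m"
    and act_add_right: "a \<in> carrier R \<Longrightarrow> act a (m + m') = act a m + act a m'"
    and act_mult: "\<lbrakk>a \<in> carrier R; b \<in> carrier R\<rbrakk> \<Longrightarrow> act (a \<otimes> b) m = act a (act b m)"
    and act_one: "act \<one> m = m"

text \<open>The tensor product of a ring \<open>A\<close>, as a right module over a subring \<open>S\<close>, with a left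
  \<open>S\<close>-module \<open>'m\<close> whose action is \<open>\<rho>\<close>: the free abelian group on the pairs modulo the usual
  relations. In \<^const>\<open>free_Abelian_group\<close> and its quotients the group operation (addition
  of tensors) is written multiplicatively.\<close>

definition pair_group :: "('a, 'r) ring_scheme \<Rightarrow> ('a \<times> 'm \<Rightarrow>\<^sub>0 int) monoid" where
  "pair_group A = free_Abelian_group (carrier A \<times> UNIV)"

definition balanced ::
    "('a, 'r) ring_scheme \<Rightarrow> 'a set \<Rightarrow> ('a \<Rightarrow> 'm \<Rightarrow> 'm) \<Rightarrow> ('a \<times> 'm::ab_group_add \<Rightarrow>\<^sub>0 int) set" where
  "balanced A S \<rho> = generate (pair_group A)
     ({frag_of (a \<oplus>\<^bsub>A\<^esub> b, m) - frag_of (a, m) - frag_of (b, m) | a b m.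
          a \<in> carrier A \<and> b \<in> carrier A} \<union>
      {frag_of (a, m + m') - frag_of (a, m) - frag_of (a, m') | a m m'. a \<in> carrier A} \<union>
      {frag_of (a \<otimes>\<^bsub>A\<^esub> s, m) - frag_of (a, \<rho> s m) | a s m. a \<in> carrier A \<and> s \<in> S})"

definition tensor ::
    "('a, 'r) ring_scheme \<Rightarrow> 'a set \<Rightarrow> ('a \<Rightarrow> 'm \<Rightarrow> 'm) \<Rightarrow> ('a \<times> 'm::ab_group_add \<Rightarrow>\<^sub>0 int) set monoid"
  where "tensor A S \<rho> = pair_group A Mod balanced A S \<rho>"

definition pure_tensor ::
    "('a, 'r) ring_scheme \<Rightarrow> 'a set \<Rightarrow> ('a \<Rightarrow> 'm \<Rightarrow> 'm) \<Rightarrow> 'a \<Rightarrow> 'm::ab_group_add \<Rightarrow>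
      ('a \<times> 'm \<Rightarrow>\<^sub>0 int) set" where
  "pure_tensor A S \<rho> a m = balanced A S \<rho> #>\<^bsub>pair_group A\<^esub> frag_of (a, m)"

text \<open>The additive map \<open>a \<otimes> m \<mapsto> \<phi> a \<otimes> m\<close> from a tensor product over \<open>A\<close> to the tensor
  product over \<open>B\<close> with data \<open>T, \<sigma>\<close>. When the map is well defined, all cosets in the union
  coincide.\<close>

definition tensor_map ::
    "('b, 'r) ring_scheme \<Rightarrow> 'b set \<Rightarrow> ('b \<Rightarrow> 'm \<Rightarrow> 'm) \<Rightarrow> ('a \<Rightarrow> 'b) \<Rightarrow>
      ('a \<times> 'm::ab_group_add \<Rightarrow>\<^sub>0 int) set \<Rightarrow> ('b \<times> 'm \<Rightarrow>\<^sub>0 int) set" where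
  "tensor_map B T \<sigma> \<phi> Z =
     (\<Union>p\<in>Z. balanced B T \<sigma> #>\<^bsub>pair_group B\<^esub> frag_extend (\<lambda>(a, m). frag_of (\<phi> a, m)) p)"


section \<open>The group of signed permutations\<close>

text \<open>The index set \<open>{1..n}\<close> is a finite linearly ordered type \<open>'n\<close>. The pair \<open>(p, e)\<close> stands
  for the signed permutation sending \<open>e\<^sub>i\<close> to \<open>e i \<cdot> e\<^sub>p\<^sub>(\<^sub>i\<^sub>)\<close>.\<close>

typedef 'n sperm = "{(p :: 'n \<Rightarrow> 'n, e :: 'n \<Rightarrow> int). bij p \<and> range e \<subseteq> {1, -1}}"
  by (rule exI[of _ "(id, \<lambda>_. 1)"]) auto

definition prm :: "'n sperm \<Rightarrow> 'n \<Rightarrow> 'n" where "prm w = fst (Rep_sperm w)"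

definition sgn_at :: "'n sperm \<Rightarrow> 'n \<Rightarrow> int" where "sgn_at w = snd (Rep_sperm w)"

instantiation sperm :: (type) "{one, times}"
begin

definition one_sperm :: "'a sperm" where
  "1 = Abs_sperm (id, \<lambda>_. 1)"

definition times_sperm :: "'a sperm \<Rightarrow> 'a sperm \<Rightarrow> 'a sperm" where
  "w * w' = Abs_sperm (prm w \<circ> prm w', \<lambda>i. sgn_at w' i * sgn_at w (prm w' i))"

instance ..

end

definition sinv :: "'n sperm \<Rightarrow> 'n sperm" where
  "sinv w = Abs_sperm (inv_into UNIV (prm w), \<lambda>i. sgn_at w (inv_into UNIV (prm w) i))"

definition swp :: "'n \<Rightarrow> 'n \<Rightarrow> 'n sperm" where
  "swp i j = Abs_sperm (transpose i j, \<lambda>_. 1)"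

definition swp_neg :: "'n \<Rightarrow> 'n \<Rightarrow> 'n sperm" where
  "swp_neg i j = Abs_sperm (transpose i j, \<lambda>k. if k = i \<or> k = j then -1 else 1)"

definition neg_at :: "'n \<Rightarrow> 'n sperm" where
  "neg_at i = Abs_sperm (id, \<lambda>k. if k = i then -1 else 1)"

lemma sperm_props: "bij (prm w)" "sgn_at w i = 1 \<or> sgn_at w i = -1"
  using Rep_sperm[of w] by (auto simp: prm_def sgn_at_def image_subset_iff)

lemma sperm_eqI: "prm w = prm w' \<Longrightarrow> sgn_at w = sgn_at w' \<Longrightarrow> w = w'"
  by (simp add: prm_def sgn_at_def prod_eq_iff flip: Rep_sperm_inject)

lemma Abs_sperm_sel:
  assumes "bij p" "\<And>i. e i = 1 \<or> e i = -1"
  shows "prm (Abs_sperm (p, e)) = p" "sgn_at (Abs_sperm (p, e)) = e"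
proof -
  have "(p, e) \<in> {(p, e). bij p \<and> range e \<subseteq> {1, -1}}" using assms by auto
  then show "prm (Abs_sperm (p, e)) = p" "sgn_at (Abs_sperm (p, e)) = e"
    by (simp_all add: prm_def sgn_at_def Abs_sperm_inverse)
qed

lemma one_sel [simp]: "prm 1 = id" "sgn_at 1 = (\<lambda>_. 1)"
  unfolding one_sperm_def by (rule Abs_sperm_sel; simp)+

lemma times_sel [simp]:
  "prm (w * w') = prm w \<circ> prm w'"
  "sgn_at (w * w') = (\<lambda>i. sgn_at w' i * sgn_at w (prm w' i))"
proof -
  have "bij (prm w \<circ> prm w')" by (intro bij_comp sperm_props)
  moreover have "sgn_at w' i * sgn_at w (prm w' i) = 1 \<or> sgn_at w' i * sgn_at w (prm w' i) = -1"
    for i using sperm_props(2)[of w' i] sperm_props(2)[of w "prm w' i"] by auto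
  ultimately show
    "prm (w * w') = prm w \<circ> prm w'"
    "sgn_at (w * w') = (\<lambda>i. sgn_at w' i * sgn_at w (prm w' i))"
    unfolding times_sperm_def by (rule Abs_sperm_sel)+
qed

lemma sinv_sel [simp]:
  "prm (sinv w) = inv_into UNIV (prm w)" "sgn_at (sinv w) = (\<lambda>i. sgn_at w (inv_into UNIV (prm w) i))"
  unfolding sinv_def
  by (rule Abs_sperm_sel[OF bij_imp_bij_inv[OF sperm_props(1)] sperm_props(2)])+

lemma swp_sel [simp]: "prm (swp i j) = transpose i j" "sgn_at (swp i j) = (\<lambda>_. 1)"
  unfolding swp_def by (rule Abs_sperm_sel; simp)+

lemma swp_neg_sel [simp]:
  "prm (swp_neg i j) = transpose i j"
  "sgn_at (swp_neg i j) = (\<lambda>k. if k = i \<or> k = j then -1 else 1)"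
  unfolding swp_neg_def by (rule Abs_sperm_sel; simp)+

lemma neg_at_sel [simp]: "prm (neg_at i) = id" "sgn_at (neg_at i) = (\<lambda>k. if k = i then -1 else 1)"
  unfolding neg_at_def by (rule Abs_sperm_sel; simp)+

instance sperm :: (type) monoid_mult
  by standard (simp_all add: sperm_eqI o_assoc mult.assoc fun_eq_iff)

lemma sinv_left: "sinv w * w = (1 :: 'n sperm)"
proof (rule sperm_eqI)
  have inj: "inj (prm w)" using sperm_props(1) by (rule bij_is_inj)
  then show "prm (sinv w * w) = prm 1" by (simp add: fun_eq_iff)
  have "sgn_at w i * sgn_at w i = 1" for i using sperm_props(2)[of w i] by auto
  then show "sgn_at (sinv w * w) = sgn_at 1" using inj by simp
qed


section \<open>The algebra \<open>K\<close> and the rational double affine Hecke-Clifford algebra\<close>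

datatype 'n kgen = Clf 'n | Grp "'n sperm"

datatype 'n hgen = Xgen 'n | Ygen 'n | Kgen "'n kgen"

text \<open>An equation \<open>l = r\<close> is recorded as the element \<open>l - r\<close>. The relations of the semidirect
  product are stated relative to the images of its generators \<open>c\<^sub>i\<close> and \<open>w\<close>, as they occur in
  two presentations.\<close>

definition K_rels :: "('n \<Rightarrow> 'a) \<Rightarrow> ('n sperm \<Rightarrow> 'a) \<Rightarrow> 'a::ring_1 set" where
  "K_rels c g =
     {c i * c i - 1 | i. True} \<union>
     {c i * c j + c j * c i | i j. i \<noteq> j} \<union>
     {g 1 - 1} \<union>
     {g w * g w' - g (w * w') | w w'. True} \<union>
     {g w * c i * g (sinv w) - of_int (sgn_at w i) * c (prm w i) | w i. True}"

abbreviation kc :: "'n \<Rightarrow> 'n kgen free_alg" where "kc i \<equiv> gen (Clf i)"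
abbreviation kg :: "'n sperm \<Rightarrow> 'n kgen free_alg" where "kg w \<equiv> gen (Grp w)"

definition K_alg :: "'n kgen free_alg set ring" where
  "K_alg = presented (K_rels kc kg)"

definition kcls :: "'n kgen free_alg \<Rightarrow> 'n kgen free_alg set" where
  "kcls a = cls (K_rels kc kg) a"

abbreviation hx :: "'n \<Rightarrow> 'n hgen free_alg" where "hx i \<equiv> gen (Xgen i)"
abbreviation hy :: "'n \<Rightarrow> 'n hgen free_alg" where "hy i \<equiv> gen (Ygen i)"
abbreviation hc :: "'n \<Rightarrow> 'n hgen free_alg" where "hc i \<equiv> gen (Kgen (Clf i))"
abbreviation hg :: "'n sperm \<Rightarrow> 'n hgen free_alg" where "hg w \<equiv> gen (Kgen (Grp w))"

definition H_rels :: "complex \<Rightarrow> complex \<Rightarrow> 'n::finite hgen free_alg set" where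
  "H_rels u v =
     K_rels hc hg \<union>
     {hx i * hx j - hx j * hx i | i j. True} \<union>
     {hy i * hy j - hy j * hy i | i j. True} \<union>
     {hy i * hc j - hc j * hy i | i j. True} \<union>
     {hx i * hc i + hc i * hx i | i. True} \<union>
     {hx i * hc j - hc j * hx i | i j. i \<noteq> j} \<union>
     {hg w * hx i * hg (sinv w) - of_int (sgn_at w i) * hx (prm w i) | w i. True} \<union>
     {hg w * hy i * hg (sinv w) - of_int (sgn_at w i) * hy (prm w i) | w i. True} \<union>
     {(hy j * hx i - hx i * hy j)
        - scal u * ((1 + hc j * hc i) * hg (swp i j) - (1 - hc j * hc i) * hg (swp_neg i j))
        | i j. i \<noteq> j} \<union>
     {(hy i * hx i - hx i * hy i)
        - (- scal u * (\<Sum>k\<in>UNIV - {i}.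
               (1 + hc k * hc i) * hg (swp k i) + (1 - hc k * hc i) * hg (swp_neg k i))
           - scal (complex_of_real (sqrt 2) * v) * hg (neg_at i))
        | i. True}"

definition H_alg :: "complex \<Rightarrow> complex \<Rightarrow> 'n::finite hgen free_alg set ring" where
  "H_alg u v = presented (H_rels u v)"

definition hcls :: "complex \<Rightarrow> complex \<Rightarrow> 'n::finite hgen free_alg \<Rightarrow> 'n hgen free_alg set" where
  "hcls u v a = cls (H_rels u v) a"

definition Hx_set :: "complex \<Rightarrow> complex \<Rightarrow> 'n::finite hgen free_alg set set" where
  "Hx_set u v = generate_ring (H_alg u v)
     (hcls u v ` (range scal \<union> range hc \<union> range hg \<union> range hx))"


section \<open>The polynomial ring in the \<open>y\<^sub>i\<close>\<close>

type_synonym 'n ypoly = "('n \<Rightarrow>\<^sub>0 nat) \<Rightarrow>\<^sub>0 complex"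

definition yconst :: "complex \<Rightarrow> 'n ypoly" where
  "yconst a = Poly_Mapping.single 0 a"

definition yvar :: "'n \<Rightarrow> 'n ypoly" where
  "yvar i = Poly_Mapping.single (Poly_Mapping.single i 1) 1"

text \<open>The action \<open>f \<mapsto> f\<^sup>w\<close> by algebra automorphisms with \<open>y\<^sub>i \<mapsto> w(y\<^sub>i)\<close>.\<close>

definition yact :: "'n::finite sperm \<Rightarrow> 'n ypoly \<Rightarrow> 'n ypoly" where
  "yact w f = (\<Sum>\<alpha>\<in>Poly_Mapping.keys f. yconst (Poly_Mapping.lookup f \<alpha>) *
      (\<Prod>i\<in>UNIV. (of_int (sgn_at w i) * yvar (prm w i)) ^ Poly_Mapping.lookup \<alpha> i))"

text \<open>The exact quotient; unique if it exists and \<open>g \<noteq> 0\<close>, as \<open>'n ypoly\<close> is an integral domain.\<close>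

definition yquot :: "'n ypoly \<Rightarrow> 'n ypoly \<Rightarrow> 'n ypoly" where
  "yquot f g = (THE q. q * g = f)"

text \<open>The element \<open>f(y\<^sub>1, \<dots>, y\<^sub>n)\<close> of the double affine algebra. The product over the indices is
  taken in increasing order, which is immaterial because the \<open>y\<^sub>i\<close> commute there.\<close>

definition yeval ::
    "complex \<Rightarrow> complex \<Rightarrow> 'n::{finite,linorder} ypoly \<Rightarrow> 'n hgen free_alg set" where
  "yeval u v f = hcls u v (\<Sum>\<alpha>\<in>Poly_Mapping.keys f. scal (Poly_Mapping.lookup f \<alpha>) *
      prod_list (map (\<lambda>i. hy i ^ Poly_Mapping.lookup \<alpha> i) (sorted_list_of_set UNIV)))"


section \<open>The induced module\<close>

text \<open>In this section \<open>act\<close> is the action on a \<open>K\<close>-module. Its extension to the subalgebra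
  generated by \<open>K\<close> and the \<open>x\<^sub>i\<close>, with \<open>x\<^sub>i\<close> acting by \<open>0\<close>, is determined by its values on
  generators; the choice operator only fixes its irrelevant values outside that subalgebra.\<close>

definition Hx_act ::
    "complex \<Rightarrow> complex \<Rightarrow> ('n::finite kgen free_alg set \<Rightarrow> 'm::ab_group_add \<Rightarrow> 'm) \<Rightarrow>
      'n hgen free_alg set \<Rightarrow> 'm \<Rightarrow> 'm" where
  "Hx_act u v act = (SOME \<rho>.
     left_module (H_alg u v\<lparr>carrier := Hx_set u v\<rparr>) \<rho> \<and>
     (\<forall>a. \<rho> (hcls u v (scal a)) = act (kcls (scal a))) \<and>
     (\<forall>i. \<rho> (hcls u v (hc i)) = act (kcls (kc i))) \<and>
     (\<forall>w. \<rho> (hcls u v (hg w)) = act (kcls (kg w))) \<and>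
     (\<forall>i m. \<rho> (hcls u v (hx i)) m = 0))"

text \<open>Left multiplication by \<open>h\<close> on the induced module \<open>M\<^sub>x\<close>, which is
  \<open>tensor (H_alg u v) (Hx_set u v) (Hx_act u v act)\<close>.\<close>

definition ind_act ::
    "complex \<Rightarrow> complex \<Rightarrow> ('n::finite kgen free_alg set \<Rightarrow> 'm::ab_group_add \<Rightarrow> 'm) \<Rightarrow>
      'n hgen free_alg set \<Rightarrow> ('n hgen free_alg set \<times> 'm \<Rightarrow>\<^sub>0 int) set \<Rightarrow>
      ('n hgen free_alg set \<times> 'm \<Rightarrow>\<^sub>0 int) set" where
  "ind_act u v act h =
     tensor_map (H_alg u v) (Hx_set u v) (Hx_act u v act) (\<lambda>b. h \<otimes>\<^bsub>H_alg u v\<^esub> b)"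

text \<open>The complex vector space \<open>\<complex>[y\<^sub>1, \<dots>, y\<^sub>n] \<otimes> M\<close>: the tensor product over the constants,
  which act on \<open>M\<close> through \<open>K\<close>. Its zero, sum and negation are those of the
  (multiplicatively written) abelian group \<open>PM act\<close>.\<close>

definition const_act ::
    "('n kgen free_alg set \<Rightarrow> 'm::ab_group_add \<Rightarrow> 'm) \<Rightarrow> 'n ypoly \<Rightarrow> 'm \<Rightarrow> 'm" where
  "const_act act p = act (kcls (scal (Poly_Mapping.lookup p 0)))"

definition PM ::
    "('n kgen free_alg set \<Rightarrow> 'm::ab_group_add \<Rightarrow> 'm) \<Rightarrow> ('n ypoly \<times> 'm \<Rightarrow>\<^sub>0 int) set monoid" where
  "PM act = tensor type_ring (range yconst) (const_act act)"

definition pt ::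
    "('n kgen free_alg set \<Rightarrow> 'm::ab_group_add \<Rightarrow> 'm) \<Rightarrow> 'n ypoly \<Rightarrow> 'm \<Rightarrow>
      ('n ypoly \<times> 'm \<Rightarrow>\<^sub>0 int) set" where
  "pt act f m = pure_tensor type_ring (range yconst) (const_act act) f m"

definition psmult ::
    "('n kgen free_alg set \<Rightarrow> 'm::ab_group_add \<Rightarrow> 'm) \<Rightarrow> complex \<Rightarrow>
      ('n ypoly \<times> 'm \<Rightarrow>\<^sub>0 int) set \<Rightarrow> ('n ypoly \<times> 'm \<Rightarrow>\<^sub>0 int) set" where
  "psmult act a = tensor_map type_ring (range yconst) (const_act act) (\<lambda>f. yconst a * f)"

text \<open>The identification of \<open>\<complex>[y\<^sub>1, \<dots>, y\<^sub>n] \<otimes> M\<close> with \<open>M\<^sub>x\<close>, sending \<open>f \<otimes> m\<close> to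
  \<open>f(y\<^sub>1, \<dots>, y\<^sub>n) \<otimes> m\<close>; it is bijective by the triangular decomposition.\<close>

definition ident ::
    "complex \<Rightarrow> complex \<Rightarrow> ('n::{finite,linorder} kgen free_alg set \<Rightarrow> 'm::ab_group_add \<Rightarrow> 'm) \<Rightarrow>
      ('n ypoly \<times> 'm \<Rightarrow>\<^sub>0 int) set \<Rightarrow> ('n hgen free_alg set \<times> 'm \<Rightarrow>\<^sub>0 int) set" where
  "ident u v act = tensor_map (H_alg u v) (Hx_set u v) (Hx_act u v act) (yeval u v)"

text \<open>The action of \<open>h\<close> on \<open>\<complex>[y\<^sub>1, \<dots>, y\<^sub>n] \<otimes> M\<close> transported along the identification.\<close>

definition PM_act ::
    "complex \<Rightarrow> complex \<Rightarrow> ('n::{finite,linorder} kgen free_alg set \<Rightarrow> 'm::ab_group_add \<Rightarrow> 'm) \<Rightarrow>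
      'n hgen free_alg set \<Rightarrow> ('n ypoly \<times> 'm \<Rightarrow>\<^sub>0 int) set \<Rightarrow> ('n ypoly \<times> 'm \<Rightarrow>\<^sub>0 int) set" where
  "PM_act u v act h t =
     the_inv_into (carrier (PM act)) (ident u v act) (ind_act u v act h (ident u v act t))"

end

(* The divided differences and the operators of K assemble to Dunkl operators D_i on an explicit
   model N of C[y] (x) M. Together with multiplication by the y_j and the diagonal action of K they
   satisfy all relations of the algebra; only [D_i, D_j] = 0 is not a direct computation: this
   commutator commutes with every y_k (Jacobi identity and the known [y_k, D_i]) and kills 1 (x) M,
   hence it vanishes. In N the subspace 1 (x) M is a K-module killed by the D_i, so the extension of
   M with x_i acting by 0 exists, and h (x) m |-> h(1 (x) m) defines a map M_x -> N. Its composite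
   with C[y] (x) M -> M_x is the canonical isomorphism, and C[y] (x) M -> M_x is onto because its
   image is stable under all generators. So the identification is bijective and carries the action
   of x_i to D_i. *)

theory Submission
  imports Defs
begin

text \<open>Pushing x_i past f(y) inside the induced module suggests the formula but does not prove
  it: the action on C[y] (x) M is transported along \<open>ident\<close>, whose injectivity is the
  triangular decomposition, and \<open>Hx_act\<close> is a choice that means nothing until some
  extension of M exists. Neither is assumed, so both are extracted from a model in which the
  right-hand side of the formula is the definition of x_i. The model is a type of finitely supported
  families and not the tensor product itself: tensors are cosets in a group record, whereas a type
  has a ring of additive endomorphisms in which the relations become plain equations. The shape of
  the Dunkl operators is dictated by the twisted Leibniz rule: the commutator of y_j with the
  divided difference f |-> (f - w(f))/r is -\<beta>_j w, where y_j - w(y_j) = \<beta>_j r, and these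
  weights reproduce the prescribed [y_j, x_i]. Expanding [D_i, D_j] directly would produce products
  of divided differences with different roots; bracketing with y_k first leaves only commutators of
  Dunkl operators with images of K, and these are governed by equivariance.\<close>

definition psum :: "('k \<Rightarrow> 'v \<Rightarrow> 'g) \<Rightarrow> ('k \<Rightarrow>\<^sub>0 'v::zero) \<Rightarrow> 'g::comm_monoid_add" where
  "psum h p = (\<Sum>k\<in>Poly_Mapping.keys p. h k (Poly_Mapping.lookup p k))"

lemma psum_single: "h k 0 = 0 \<Longrightarrow> psum h (Poly_Mapping.single k v) = h k v"
  by (cases "v = 0") (simp_all add: psum_def)

lemma psum_superset:
  assumes "\<And>k. h k 0 = 0" "finite S" "Poly_Mapping.keys p \<subseteq> S"
  shows "psum h p = (\<Sum>k\<in>S. h k (Poly_Mapping.lookup p k))"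
  unfolding psum_def using assms
  by (intro sum.mono_neutral_left) (auto simp: in_keys_iff)

text \<open>Additivity in the coefficient forces \<open>h k 0 = 0\<close>, so all three sums may run
  over the union of the supports, and cancellation in \<open>p + q\<close> does no harm. Evaluation
  of free algebras, \<open>yact\<close>, \<open>tm\<close> and \<open>yev\<close> are all instances
  of \<open>psum\<close>.\<close>

lemma psum_add:
  fixes h :: "'k \<Rightarrow> 'v::comm_monoid_add \<Rightarrow> 'g::ab_group_add"
  assumes h: "\<And>k a b. h k (a + b) = h k a + h k b"
  shows "psum h (p + q) = psum h p + psum h q"
proof -
  let ?S = "Poly_Mapping.keys p \<union> Poly_Mapping.keys q"
  have 0: "h k 0 = 0" for k using h[of k 0 0] by simp
  have "psum h (p + q) = (\<Sum>k\<in>?S. h k (Poly_Mapping.lookup (p + q) k))"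
    by (rule psum_superset) (use keys_add[of p q] in \<open>auto simp: 0\<close>)
  also have "\<dots> = (\<Sum>k\<in>?S. h k (Poly_Mapping.lookup p k)) + (\<Sum>k\<in>?S. h k (Poly_Mapping.lookup q k))"
    by (simp add: lookup_add h sum.distrib)
  also have "\<dots> = psum h p + psum h q"
    using psum_superset[of h ?S p] psum_superset[of h ?S q] by (simp add: 0)
  finally show ?thesis .
qed

lemma poly_mapping_expand: "p = psum Poly_Mapping.single p"
proof (rule poly_mapping_eqI)
  fix k
  have "Poly_Mapping.lookup (psum Poly_Mapping.single p) k =
      (\<Sum>j\<in>Poly_Mapping.keys p. if k = j then Poly_Mapping.lookup p j else 0)"
    by (auto simp: psum_def lookup_sum lookup_single when_def intro!: sum.cong)
  also have "\<dots> = Poly_Mapping.lookup p k"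
    by (simp add: in_keys_iff)
  finally show "Poly_Mapping.lookup p k = Poly_Mapping.lookup (psum Poly_Mapping.single p) k" ..
qed

lemma poly_mapping_add_induct [case_names single add]:
  fixes p :: "'k \<Rightarrow>\<^sub>0 'v::comm_monoid_add"
  assumes single: "\<And>k v. P (Poly_Mapping.single k v)"
    and add: "\<And>p q. P p \<Longrightarrow> P q \<Longrightarrow> P (p + q)"
  shows "P p"
proof -
  have 0: "P 0" using single[of undefined 0] by simp
  have "P (\<Sum>k\<in>S. Poly_Mapping.single k (Poly_Mapping.lookup p k))" if "finite S" for S
    using that by induction (auto intro: 0 single add)
  then show ?thesis
    by (subst poly_mapping_expand) (simp add: psum_def)
qed

locale unital_hom =
  fixes f :: "'a::{ring, monoid_mult} \<Rightarrow> 'b::{ring, monoid_mult}"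
  assumes hom_add: "f (a + b) = f a + f b"
    and hom_mult: "f (a * b) = f a * f b"
    and hom_one [simp]: "f 1 = 1"
begin

lemma hom_zero [simp]: "f 0 = 0"
  using hom_add[of 0 0] by simp

lemma hom_uminus: "f (- a) = - f a"
  using hom_add[of a "- a"] by (simp add: minus_unique)

lemma hom_diff: "f (a - b) = f a - f b"
  using hom_add[of a "- b"] by (simp add: hom_uminus)

lemma hom_sum: "f (sum h S) = (\<Sum>x\<in>S. f (h x))"
  by (induction S rule: infinite_finite_induct) (simp_all add: hom_add)

lemmas hom_simps = hom_add hom_mult hom_uminus hom_diff hom_sum

end

lemma hom_sign:
  fixes f :: "'a::ring_1 \<Rightarrow> 'b::{ring, monoid_mult}"
  assumes "unital_hom f" "e = 1 \<or> e = -1"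
  shows "f (of_int e * a) = (if e = 1 then f a else - f a)"
  using assms by (auto simp: unital_hom.hom_uminus)


subsection \<open>Free algebras and their quotients\<close>

primrec letters :: "'g word \<Rightarrow> 'g list" where
  "letters (Word xs) = xs"

lemma letters_simps [simp]: "letters 0 = []" "letters (w + w') = letters w @ letters w'"
  by (simp_all add: zero_word_def) (cases w; cases w'; simp)

lemma scal_simps: "scal (a + b) = scal a + scal b" "scal (a * b) = scal a * scal b" "scal 1 = 1"
  by (simp_all add: scal_def single_add mult_single)

lemma scal_commute: "scal a * x = x * scal a"
proof (induction x rule: poly_mapping_add_induct)
  case (single k v)
  then show ?case by (simp add: scal_def mult_single mult.commute)
qed (simp add: algebra_simps)

lemma free_alg_induct [case_names scal gen add mult]:
  assumes scal: "\<And>a. P (scal a)" and gen: "\<And>g. P (gen g)"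
    and add: "\<And>x y. P x \<Longrightarrow> P y \<Longrightarrow> P (x + y)" and mult: "\<And>x y. P x \<Longrightarrow> P y \<Longrightarrow> P (x * y)"
  shows "P x"
proof (induction x rule: poly_mapping_add_induct)
  case (single w a)
  have "P (Poly_Mapping.single (Word xs) 1)" for xs
  proof (induction xs)
    case Nil
    then show ?case using scal[of 1] by (simp add: scal_def zero_word_def)
  next
    case (Cons g xs)
    then show ?case using mult[OF gen[of g] Cons.IH] by (simp add: gen_def mult_single)
  qed
  then have "P (scal a * Poly_Mapping.single w 1)"
    by (cases w) (auto intro: mult scal)
  then show ?case by (simp add: scal_def mult_single)
qed (rule add)

text \<open>Evaluation of the free algebra at \<open>\<phi>\<close>. The target has no complex
  structure of its own: scalars enter through a ring homomorphism \<open>\<sigma>\<close>, whose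
  values must commute with those of \<open>\<phi>\<close>.\<close>

definition free_hom :: "(complex \<Rightarrow> 'r) \<Rightarrow> ('g \<Rightarrow> 'r) \<Rightarrow> 'g free_alg \<Rightarrow> 'r::{ring, monoid_mult}" where
  "free_hom \<sigma> \<phi> = psum (\<lambda>w a. \<sigma> a * prod_list (map \<phi> (letters w)))"

locale free_hom_data = unital_hom \<sigma> for \<sigma> :: "complex \<Rightarrow> 'r::{ring, monoid_mult}" +
  fixes \<phi> :: "'g \<Rightarrow> 'r"
  assumes commute: "\<sigma> a * \<phi> g = \<phi> g * \<sigma> a"
begin

lemma commute_prod_list: "\<sigma> a * prod_list (map \<phi> xs) = prod_list (map \<phi> xs) * \<sigma> a"
proof (induction xs)
  case (Cons x xs)
  have "\<sigma> a * prod_list (map \<phi> (x # xs)) = \<phi> x * (\<sigma> a * prod_list (map \<phi> xs))"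
    by (simp add: commute flip: mult.assoc)
  then show ?case by (simp add: Cons.IH mult.assoc)
qed simp

lemma free_hom_single:
  "free_hom \<sigma> \<phi> (Poly_Mapping.single w a) = \<sigma> a * prod_list (map \<phi> (letters w))"
  by (simp add: free_hom_def psum_single)

lemma free_hom_add: "free_hom \<sigma> \<phi> (x + y) = free_hom \<sigma> \<phi> x + free_hom \<sigma> \<phi> y"
  unfolding free_hom_def by (rule psum_add) (simp add: hom_add algebra_simps)

lemma free_hom_gen: "free_hom \<sigma> \<phi> (gen g) = \<phi> g"
  and free_hom_scal: "free_hom \<sigma> \<phi> (scal a) = \<sigma> a"
  by (simp_all add: gen_def scal_def free_hom_single)

lemma free_hom_mult: "free_hom \<sigma> \<phi> (x * y) = free_hom \<sigma> \<phi> x * free_hom \<sigma> \<phi> y"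
proof (induction x rule: poly_mapping_add_induct)
  case (single w a)
  show ?case
  proof (induction y rule: poly_mapping_add_induct)
    case (single w' b)
    have "\<sigma> b * prod_list (map \<phi> (letters w)) * prod_list (map \<phi> (letters w')) =
        prod_list (map \<phi> (letters w)) * (\<sigma> b * prod_list (map \<phi> (letters w')))"
      by (simp add: commute_prod_list mult.assoc)
    then show ?case
      by (simp add: mult_single free_hom_single hom_mult mult.assoc)
  qed (simp add: free_hom_add algebra_simps)
qed (simp add: free_hom_add algebra_simps)

sublocale free: unital_hom "free_hom \<sigma> \<phi>"
proof
  show "free_hom \<sigma> \<phi> 1 = 1"
    using free_hom_scal[of 1] by (simp add: scal_simps)
qed (simp_all add: free_hom_add free_hom_mult)

end

lemma type_ring_simps [simp]:
  "carrier (type_ring :: 'a::ring_1 ring) = UNIV"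
  "a \<otimes>\<^bsub>type_ring\<^esub> b = a * b" "a \<oplus>\<^bsub>type_ring\<^esub> b = a + b"
  "\<one>\<^bsub>type_ring\<^esub> = 1" "\<zero>\<^bsub>type_ring\<^esub> = 0"
  by (simp_all add: type_ring_def)

lemma ring_type_ring: "ring (type_ring :: 'a::ring_1 ring)"
proof (intro ringI abelian_groupI monoidI)
  fix x :: 'a
  show "\<exists>y\<in>carrier type_ring. y \<oplus>\<^bsub>type_ring\<^esub> x = \<zero>\<^bsub>type_ring\<^esub>"
    by (auto intro!: exI[of _ "- x"])
qed (auto simp: algebra_simps)

lemma type_ring_uminus [simp]: "\<ominus>\<^bsub>type_ring\<^esub> a = - (a :: 'a::ring_1)"
  using abelian_group.minus_equality[OF ring.is_abelian_group[OF ring_type_ring], of "- a" a] by simp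

lemma ideal_Idl: "ideal (Idl\<^bsub>type_ring\<^esub> R) (type_ring :: 'a::ring_1 ring)"
  by (rule ring.genideal_ideal[OF ring_type_ring]) simp

lemma ring_presented: "ring (presented R)"
  unfolding presented_def by (rule ideal.quotient_is_ring[OF ideal_Idl])

lemma cls_hom: "cls R \<in> ring_hom type_ring (presented R)"
  unfolding presented_def cls_def[abs_def] by (rule ideal.rcos_ring_hom[OF ideal_Idl])

lemma carrier_presented: "carrier (presented R) = range (cls R)"
  by (auto simp: presented_def FactRing_def A_RCOSETS_def' cls_def)

lemma cls_closed [simp]: "cls R a \<in> carrier (presented R)"
  by (simp add: carrier_presented)

lemma cls_mult: "cls R a \<otimes>\<^bsub>presented R\<^esub> cls R b = cls R (a * b)"
  and cls_add: "cls R a \<oplus>\<^bsub>presented R\<^esub> cls R b = cls R (a + b)"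
  and cls_one: "\<one>\<^bsub>presented R\<^esub> = cls R 1"
  using ring_hom_mult[OF cls_hom, of a b R] ring_hom_add[OF cls_hom, of a b R]
    ring_hom_one[OF cls_hom, of R] by simp_all

lemma cls_uminus: "\<ominus>\<^bsub>presented R\<^esub> cls R a = cls R (- a)"
proof -
  interpret ring "presented R" by (rule ring_presented)
  have z: "\<zero>\<^bsub>presented R\<^esub> = cls R 0"
    using cls_add[of R 0 0] by (metis add.l_cancel_one cls_closed add_0)
  show ?thesis
    by (rule minus_equality) (simp_all add: cls_add z)
qed

lemma cls_eq_iff: "cls R a = cls R b \<longleftrightarrow> a - b \<in> Idl\<^bsub>type_ring\<^esub> R"
  using ring.quotient_eq_iff_same_a_r_cos[OF ring_type_ring ideal_Idl, of a b R]
  by (simp add: cls_def a_minus_def)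

lemma cls_relI: "a - b \<in> R \<Longrightarrow> cls R a = cls R b"
  unfolding cls_eq_iff using ring.genideal_self[OF ring_type_ring, of R] by auto

text \<open>The kernel of \<open>f\<close> is a two-sided ideal containing \<open>R\<close>, hence
  contains the ideal generated by \<open>R\<close>. This is the universal property of
  \<open>presented R\<close>, stated on representatives.\<close>

lemma hom_Idl_factor:
  fixes f :: "'g free_alg \<Rightarrow> 'r::{ring, monoid_mult}"
  assumes f: "unital_hom f" and R: "\<And>r. r \<in> R \<Longrightarrow> f r = 0" and eq: "cls R a = cls R b"
  shows "f a = f b"
proof -
  interpret unital_hom f by (rule f)
  interpret T: ring "type_ring :: 'g free_alg ring" by (rule ring_type_ring)
  have "ideal {r. f r = 0} (type_ring :: 'g free_alg ring)"
  proof (rule idealI)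
    show "subgroup {r. f r = 0} (add_monoid type_ring)"
      by (intro T.add.subgroupI) (auto simp: hom_simps simp flip: a_inv_def intro: exI[of _ 0])
  qed (auto simp: hom_simps ring_type_ring)
  then have "Idl\<^bsub>type_ring\<^esub> R \<subseteq> {r. f r = 0}"
    by (rule T.genideal_minimal) (use R in auto)
  then show ?thesis
    using eq by (auto simp: cls_eq_iff hom_simps)
qed


subsection \<open>The ring of additive endomorphisms\<close>

text \<open>Endomorphisms of the zero group satisfy \<open>0 = 1\<close>, so the type of endomorphisms is only of sort
  \<open>{ring, monoid_mult}\<close> and not an instance of \<open>ring_1\<close>.\<close>

typedef (overloaded) 'a endo = "{f :: 'a::ab_group_add \<Rightarrow> 'a. \<forall>x y. f (x + y) = f x + f y}"
  morphisms app Endo by (rule exI[of _ "\<lambda>x. x"]) simp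

setup_lifting type_definition_endo

lemma endo_eqI: "(\<And>x. app S x = app T x) \<Longrightarrow> S = T"
  by (simp add: app_inject[symmetric] fun_eq_iff)

lemma app_add [simp]: "app T (x + y) = app T x + app T y"
  using app[of T] by simp

lemma app_zero [simp]: "app T 0 = 0"
  using app_add[of T 0 0] by simp

lemma app_Endo: "(\<And>x y. f (x + y) = f x + f y) \<Longrightarrow> app (Endo f) = f"
  by (simp add: Endo_inverse)

instantiation endo :: (ab_group_add) ring
begin

lift_definition zero_endo :: "'a endo" is "\<lambda>_. 0" by simp
lift_definition plus_endo :: "'a endo \<Rightarrow> 'a endo \<Rightarrow> 'a endo" is "\<lambda>S T x. S x + T x"
  by (simp add: algebra_simps)
lift_definition uminus_endo :: "'a endo \<Rightarrow> 'a endo" is "\<lambda>T x. - T x" by simp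
lift_definition minus_endo :: "'a endo \<Rightarrow> 'a endo \<Rightarrow> 'a endo" is "\<lambda>S T x. S x - T x" by simp
lift_definition times_endo :: "'a endo \<Rightarrow> 'a endo \<Rightarrow> 'a endo" is "\<lambda>S T x. S (T x)" by simp

instance
  by standard (transfer, simp add: fun_eq_iff algebra_simps)+

end

instantiation endo :: (ab_group_add) monoid_mult
begin
lift_definition one_endo :: "'a endo" is "\<lambda>x. x" by simp
instance by standard (transfer, simp)+
end


subsection \<open>Tensor products\<close>

locale tensor_data = ring A for A :: "('a, 'r) ring_scheme" (structure) +
  fixes S :: "'a set" and \<rho> :: "'a \<Rightarrow> 'm::ab_group_add \<Rightarrow> 'm"
  assumes S_closed: "s \<in> S \<Longrightarrow> s \<in> carrier A"
begin

definition relators :: "('a \<times> 'm \<Rightarrow>\<^sub>0 int) set" where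
  "relators =
     {frag_of (a \<oplus> b, m) - frag_of (a, m) - frag_of (b, m) | a b m. a \<in> carrier A \<and> b \<in> carrier A} \<union>
     {frag_of (a, m + m') - frag_of (a, m) - frag_of (a, m') | a m m'. a \<in> carrier A} \<union>
     {frag_of (a \<otimes> s, m) - frag_of (a, \<rho> s m) | a s m. a \<in> carrier A \<and> s \<in> S}"

abbreviation "G \<equiv> pair_group A :: ('a \<times> 'm \<Rightarrow>\<^sub>0 int) monoid"
abbreviation "B \<equiv> balanced A S \<rho>"
abbreviation "T \<equiv> tensor A S \<rho>"
abbreviation "pure \<equiv> pure_tensor A S \<rho>"

lemma balanced_eq: "B = generate G relators"
  by (simp add: balanced_def relators_def)

sublocale G: comm_group G
  by (simp add: pair_group_def abelian_free_Abelian_group)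

lemma G_simps [simp]:
  "x \<in> carrier G \<longleftrightarrow> Poly_Mapping.keys x \<subseteq> carrier A \<times> UNIV"
  "x \<otimes>\<^bsub>G\<^esub> y = x + y" "\<one>\<^bsub>G\<^esub> = 0"
  by (simp_all add: pair_group_def)

lemma inv_G: "x \<in> carrier G \<Longrightarrow> inv\<^bsub>G\<^esub> x = - x"
  by (simp add: pair_group_def)

lemma frag_of_closed: "a \<in> carrier A \<Longrightarrow> frag_of (a, m) \<in> carrier G"
  by simp

lemma diff_closed_G: "x \<in> carrier G \<Longrightarrow> y \<in> carrier G \<Longrightarrow> x - y \<in> carrier G"
  using keys_diff[of x y] by auto

lemma relators_closed: "relators \<subseteq> carrier G"
  unfolding relators_def using S_closed
  by (auto simp del: G_simps(1) intro!: diff_closed_G frag_of_closed)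

lemma subgroup_balanced: "subgroup B G"
  unfolding balanced_eq by (rule G.generate_is_subgroup[OF relators_closed])

sublocale B: normal B G
  using subgroup_balanced by (simp add: G.normal_iff_subgroup)

sublocale T: comm_group T
  unfolding tensor_def by (rule G.abelian_FactGroup[OF subgroup_balanced])

lemma pure_eq: "pure a m = B #>\<^bsub>G\<^esub> frag_of (a, m)"
  by (simp add: pure_tensor_def)

lemma coset_closed: "x \<in> carrier G \<Longrightarrow> B #>\<^bsub>G\<^esub> x \<in> carrier T"
  unfolding tensor_def carrier_FactGroup by blast

lemma coset_add: "x \<in> carrier G \<Longrightarrow> y \<in> carrier G \<Longrightarrow>
    B #>\<^bsub>G\<^esub> (x + y) = (B #>\<^bsub>G\<^esub> x) \<otimes>\<^bsub>T\<^esub> (B #>\<^bsub>G\<^esub> y)"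
  unfolding tensor_def using B.rcos_sum[of x y] by simp

lemma coset_eqI:
  assumes "x \<in> carrier G" "y \<in> carrier G" "x - y \<in> B"
  shows "B #>\<^bsub>G\<^esub> x = B #>\<^bsub>G\<^esub> y"
proof -
  have "x \<in> B #>\<^bsub>G\<^esub> y"
    using assms(3) by (force simp: r_coset_def)
  then show ?thesis
    using G.repr_independence[OF _ _ subgroup_balanced] assms(2) by blast
qed

lemma pure_closed [simp]: "a \<in> carrier A \<Longrightarrow> pure a m \<in> carrier T"
  unfolding pure_eq by (intro coset_closed frag_of_closed)

lemma relators_balanced: "x \<in> relators \<Longrightarrow> x \<in> B"
  unfolding balanced_eq by (rule generate.incl)

lemma add_closed_G: "x \<in> carrier G \<Longrightarrow> y \<in> carrier G \<Longrightarrow> x + y \<in> carrier G"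
  using G.m_closed[of x y] by (simp del: G_simps(1))

lemma pure_add_left:
  assumes "a \<in> carrier A" "b \<in> carrier A"
  shows "pure (a \<oplus> b) m = pure a m \<otimes>\<^bsub>T\<^esub> pure b m"
proof -
  have "frag_of (a \<oplus> b, m) - (frag_of (a, m) + frag_of (b, m)) \<in> B"
    by (rule relators_balanced) (use assms in \<open>auto simp: relators_def diff_diff_eq\<close>)
  then show ?thesis
    unfolding pure_eq using assms
    by (subst coset_add[symmetric]) (simp_all only: frag_of_closed add_closed_G add.m_closed coset_eqI)
qed

lemma pure_add_right:
  assumes "a \<in> carrier A"
  shows "pure a (m + m') = pure a m \<otimes>\<^bsub>T\<^esub> pure a m'"
proof -
  have "frag_of (a, m + m') - (frag_of (a, m) + frag_of (a, m')) \<in> B"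
    by (rule relators_balanced) (use assms in \<open>auto simp: relators_def diff_diff_eq\<close>)
  then show ?thesis
    unfolding pure_eq using assms
    by (subst coset_add[symmetric]) (simp_all only: frag_of_closed add_closed_G add.m_closed coset_eqI)
qed

lemma pure_balanced:
  assumes "a \<in> carrier A" "s \<in> S"
  shows "pure (a \<otimes> s) m = pure a (\<rho> s m)"
proof -
  have "frag_of (a \<otimes> s, m) - frag_of (a, \<rho> s m) \<in> B"
    by (rule relators_balanced) (use assms in \<open>auto simp: relators_def\<close>)
  then show ?thesis
    unfolding pure_eq using assms S_closed
    by (intro coset_eqI frag_of_closed) auto
qed

lemma pure_zero_right:
  assumes "a \<in> carrier A"
  shows "pure a 0 = \<one>\<^bsub>T\<^esub>"
  using pure_add_right[OF assms, of 0 0] assms by simp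

lemma pure_zero_left: "pure \<zero> m = \<one>\<^bsub>T\<^esub>"
  using pure_add_left[of \<zero> \<zero> m] by simp

text \<open>A case for inverses is dispensable because the inverse of the pure tensor of a and m is
  that of a and -m.\<close>

lemma tensor_induct [consumes 1, case_names pure mult]:
  assumes z: "z \<in> carrier T"
    and pure: "\<And>a m. a \<in> carrier A \<Longrightarrow> P (pure a m)"
    and mult: "\<And>x y. x \<in> carrier T \<Longrightarrow> y \<in> carrier T \<Longrightarrow> P x \<Longrightarrow> P y \<Longrightarrow> P (x \<otimes>\<^bsub>T\<^esub> y)"
  shows "P z"
proof -
  obtain p where p: "p \<in> carrier G" and zp: "z = B #>\<^bsub>G\<^esub> p"
    using z unfolding tensor_def carrier_FactGroup by blast
  have one: "P \<one>\<^bsub>T\<^esub>"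
    using pure[of \<zero> 0] by (simp add: pure_zero_left)
  have one_eq: "B #>\<^bsub>G\<^esub> 0 = \<one>\<^bsub>T\<^esub>"
    using G.coset_join2[OF _ subgroup_balanced, of 0] subgroup.one_closed[OF subgroup_balanced]
    by (simp add: tensor_def)
  have minus: "- x \<in> carrier G" if "x \<in> carrier G" for x
    using G.inv_closed[OF that] inv_G[OF that] by (simp del: G_simps(1))
  \<comment> \<open>\<open>frag_induction\<close> builds elements as differences, so the claim is
    carried for \<open>p\<close> and \<open>- p\<close> together.\<close>
  have "p \<in> carrier G \<and> P (B #>\<^bsub>G\<^esub> p) \<and> P (B #>\<^bsub>G\<^esub> (- p))"
    using p unfolding G_simps(1)
  proof (induction p rule: frag_induction)
    case zero
    then show ?case by (simp add: one_eq one)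
  next
    case (one x)
    obtain a m where x: "x = (a, m)" and a: "a \<in> carrier A" using one by auto
    have "(B #>\<^bsub>G\<^esub> (- frag_of x)) \<otimes>\<^bsub>T\<^esub> pure a m = \<one>\<^bsub>T\<^esub>"
      unfolding pure_eq x using a by (subst coset_add[symmetric]) (simp_all add: one_eq)
    moreover have "pure a (- m) \<otimes>\<^bsub>T\<^esub> pure a m = \<one>\<^bsub>T\<^esub>"
      using pure_add_right[OF a, of "- m" m] by (simp add: pure_zero_right[OF a])
    moreover have "B #>\<^bsub>G\<^esub> (- frag_of x) \<in> carrier T"
      by (intro coset_closed minus) (use a x in auto)
    ultimately have "B #>\<^bsub>G\<^esub> (- frag_of x) = pure a (- m)"
      using a by (metis T.r_cancel pure_closed)
    then show ?case
      using pure[OF a, of m] pure[OF a, of "- m"] a by (simp add: pure_eq x)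
  next
    case (diff a b)
    then have ab: "a \<in> carrier G" "b \<in> carrier G" by auto
    have "P (B #>\<^bsub>G\<^esub> (x + - y))"
      if "x \<in> carrier G" "y \<in> carrier G" "P (B #>\<^bsub>G\<^esub> x)" "P (B #>\<^bsub>G\<^esub> (- y))" for x y
      unfolding coset_add[OF that(1) minus[OF that(2)]]
      by (intro mult coset_closed minus that)
    from this[of a b] this[of b a] show ?case
      using diff ab diff_closed_G[OF ab] by simp
  qed
  then show ?thesis using zp by simp
qed

text \<open>The kernel of \<open>\<psi>\<close> is a subgroup containing the relators, hence all of
  \<open>B\<close>. Both the universal property and the well-definedness of
  \<open>tensor_map\<close> rest on this.\<close>

lemma hom_coset_const:
  assumes \<psi>: "\<psi> \<in> hom G H" and H: "group H" and ker: "\<And>r. r \<in> relators \<Longrightarrow> \<psi> r = \<one>\<^bsub>H\<^esub>"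
    and p: "p \<in> carrier G" and q: "q \<in> B #>\<^bsub>G\<^esub> p"
  shows "\<psi> q = \<psi> p"
proof -
  interpret \<psi>: group_hom G H \<psi>
    using \<psi> H by (simp add: group_hom_def group_hom_axioms_def G.is_group)
  obtain b where b: "b \<in> B" and q: "q = b + p"
    using q by (auto simp: r_coset_def)
  have "\<psi> b = \<one>\<^bsub>H\<^esub>"
    using G.generate_subgroup_incl[OF _ \<psi>.subgroup_kernel, of relators] b relators_closed ker
    unfolding balanced_eq kernel_def by blast
  moreover have "b \<in> carrier G"
    using b subgroup.subset[OF subgroup_balanced] by blast
  ultimately show ?thesis
    using \<psi>.hom_mult[of b p] p q by (simp del: G_simps(1))
qed

lemma tensor_universal:
  assumes H: "comm_group H"
    and closed: "\<And>a m. a \<in> carrier A \<Longrightarrow> \<beta> a m \<in> carrier H"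
    and left: "\<And>a b m. a \<in> carrier A \<Longrightarrow> b \<in> carrier A \<Longrightarrow> \<beta> (a \<oplus> b) m = \<beta> a m \<otimes>\<^bsub>H\<^esub> \<beta> b m"
    and right: "\<And>a m m'. a \<in> carrier A \<Longrightarrow> \<beta> a (m + m') = \<beta> a m \<otimes>\<^bsub>H\<^esub> \<beta> a m'"
    and bal: "\<And>a s m. a \<in> carrier A \<Longrightarrow> s \<in> S \<Longrightarrow> \<beta> (a \<otimes> s) m = \<beta> a (\<rho> s m)"
  obtains h where "h \<in> hom T H" "\<And>a m. a \<in> carrier A \<Longrightarrow> h (pure a m) = \<beta> a m"
proof -
  interpret H: comm_group H by (rule H)
  obtain \<psi> where \<psi>: "\<psi> \<in> hom G H" and \<psi>_of: "\<And>a m. a \<in> carrier A \<Longrightarrow> \<psi> (frag_of (a, m)) = \<beta> a m"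
    by (rule H.free_Abelian_group_universal[of "case_prod \<beta>" "carrier A \<times> (UNIV :: 'm set)"])
       (use closed in \<open>auto simp: image_subset_iff pair_group_def\<close>)
  interpret \<psi>: group_hom G H \<psi>
    using \<psi> by (simp add: group_hom_def group_hom_axioms_def G.is_group H.is_group)
  have \<psi>_diff: "\<psi> (x - y) = \<psi> x \<otimes>\<^bsub>H\<^esub> inv\<^bsub>H\<^esub> \<psi> y" if "x \<in> carrier G" "y \<in> carrier G" for x y
    using \<psi>.hom_mult[OF that(1) G.inv_closed[OF that(2)]] \<psi>.hom_inv[OF that(2)] inv_G[OF that(2)]
    by simp
  have ker: "\<psi> r = \<one>\<^bsub>H\<^esub>" if "r \<in> relators" for r
  proof -
    have "x \<otimes>\<^bsub>H\<^esub> y \<otimes>\<^bsub>H\<^esub> inv\<^bsub>H\<^esub> x \<otimes>\<^bsub>H\<^esub> inv\<^bsub>H\<^esub> y = \<one>\<^bsub>H\<^esub>" if "x \<in> carrier H" "y \<in> carrier H" for x y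
      using that by (simp add: H.m_comm[of x y] H.m_assoc)
    then show ?thesis
      using that S_closed unfolding relators_def
      by (auto simp del: G_simps(1) simp: \<psi>_diff \<psi>_of left right bal closed frag_of_closed
          diff_closed_G)
  qed
  obtain h where h: "h \<in> hom T H" "\<And>x. x \<in> carrier G \<Longrightarrow> h (B #>\<^bsub>G\<^esub> x) = \<psi> x"
  proof (rule FactGroup_universal[OF \<psi> B.normal_axioms])
    fix x y assume xy: "x \<in> carrier G" "y \<in> carrier G" "B #>\<^bsub>G\<^esub> x = B #>\<^bsub>G\<^esub> y"
    show "\<psi> x = \<psi> y"
      by (rule hom_coset_const[OF \<psi> H.is_group ker xy(2)])
         (use G.rcos_self[OF xy(1) subgroup_balanced] xy(3) in simp_all)
  qed (auto simp: tensor_def)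
  then show thesis
    using that by (simp add: pure_eq \<psi>_of)
qed

end

text \<open>\<open>compat\<close> is demanded only after passing to tensors, because
  \<open>S\<close> and \<open>T\<close> may lie in different rings: for the identification they are
  the constant polynomials and \<open>Hx_set\<close>.\<close>

locale tensor_map_data = A: tensor_data A S \<rho> + B: tensor_data B T \<sigma>
  for A :: "('a, 'r) ring_scheme" and S and \<rho> :: "'a \<Rightarrow> 'm::ab_group_add \<Rightarrow> 'm"
    and B :: "('b, 'q) ring_scheme" and T and \<sigma> :: "'b \<Rightarrow> 'm \<Rightarrow> 'm" +
  fixes \<phi> :: "'a \<Rightarrow> 'b"
  assumes closed: "a \<in> carrier A \<Longrightarrow> \<phi> a \<in> carrier B"
    and additive: "a \<in> carrier A \<Longrightarrow> b \<in> carrier A \<Longrightarrow> \<phi> (a \<oplus>\<^bsub>A\<^esub> b) = \<phi> a \<oplus>\<^bsub>B\<^esub> \<phi> b"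
    and compat: "a \<in> carrier A \<Longrightarrow> s \<in> S \<Longrightarrow>
      pure_tensor B T \<sigma> (\<phi> (a \<otimes>\<^bsub>A\<^esub> s)) m = pure_tensor B T \<sigma> (\<phi> a) (\<rho> s m)"
begin

definition ext :: "('a \<times> 'm \<Rightarrow>\<^sub>0 int) \<Rightarrow> ('b \<times> 'm \<Rightarrow>\<^sub>0 int)" where
  "ext = frag_extend (\<lambda>(a, m). frag_of (\<phi> a, m))"

lemma ext_closed: "p \<in> carrier A.G \<Longrightarrow> ext p \<in> carrier B.G"
  unfolding ext_def using closed
  by (auto dest!: subsetD[OF keys_frag_extend])

lemma ext_hom: "(\<lambda>p. B.B #>\<^bsub>B.G\<^esub> ext p) \<in> hom A.G B.T"
proof (rule homI)
  fix p q assume "p \<in> carrier A.G" "q \<in> carrier A.G"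
  then show "B.B #>\<^bsub>B.G\<^esub> ext (p \<otimes>\<^bsub>A.G\<^esub> q) = (B.B #>\<^bsub>B.G\<^esub> ext p) \<otimes>\<^bsub>B.T\<^esub> (B.B #>\<^bsub>B.G\<^esub> ext q)"
    using B.coset_add[OF ext_closed ext_closed] by (simp add: ext_def frag_extend_add)
qed (intro B.coset_closed ext_closed)

lemma ext_relator:
  assumes "r \<in> A.relators"
  shows "B.B #>\<^bsub>B.G\<^esub> ext r = \<one>\<^bsub>B.T\<^esub>"
proof -
  have eq: "B.B #>\<^bsub>B.G\<^esub> (x - y) = \<one>\<^bsub>B.T\<^esub>"
    if "B.B #>\<^bsub>B.G\<^esub> x = B.B #>\<^bsub>B.G\<^esub> y" "x \<in> carrier B.G" "y \<in> carrier B.G" for x y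
    using B.coset_add[of "x - y" y] that B.coset_closed B.diff_closed_G
    by (simp del: B.G_simps(1))
  have ext_of: "ext (frag_of (a, m)) = frag_of (\<phi> a, m)" for a m by (simp add: ext_def)
  have ext_diff: "ext (x - y) = ext x - ext y" and ext_add: "ext (x + y) = ext x + ext y" for x y
    by (simp_all add: ext_def frag_extend_diff frag_extend_add)
  note simps = ext_of ext_diff ext_add additive B.pure_add_left B.pure_add_right compat closed
    B.coset_add[OF B.frag_of_closed B.frag_of_closed] B.pure_eq[symmetric]
  consider (l) a b m where "a \<in> carrier A" "b \<in> carrier A"
      "r = frag_of (a \<oplus>\<^bsub>A\<^esub> b, m) - (frag_of (a, m) + frag_of (b, m))"
    | (r) a m m' where "a \<in> carrier A" "r = frag_of (a, m + m') - (frag_of (a, m) + frag_of (a, m'))"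
    | (b) a s m where "a \<in> carrier A" "s \<in> S" "r = frag_of (a \<otimes>\<^bsub>A\<^esub> s, m) - frag_of (a, \<rho> s m)"
    using assms unfolding A.relators_def diff_diff_eq by auto
  then show ?thesis
  proof cases
    case l
    show ?thesis unfolding l(3) ext_diff
      by (rule eq) (use l in \<open>simp_all add: simps B.add_closed_G B.frag_of_closed A.add.m_closed del: B.G_simps(1)\<close>)
  next
    case r
    show ?thesis unfolding r(2) ext_diff
      by (rule eq) (use r in \<open>simp_all add: simps B.add_closed_G B.frag_of_closed del: B.G_simps(1)\<close>)
  next
    case b
    show ?thesis unfolding b(3) ext_diff
      by (rule eq) (use b A.S_closed in \<open>simp_all add: simps B.frag_of_closed del: B.G_simps(1)\<close>)
  qed
qed

lemma tensor_map_coset: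
  assumes "p \<in> carrier A.G"
  shows "tensor_map B T \<sigma> \<phi> (A.B #>\<^bsub>A.G\<^esub> p) = B.B #>\<^bsub>B.G\<^esub> ext p"
proof -
  have "B.B #>\<^bsub>B.G\<^esub> ext q = B.B #>\<^bsub>B.G\<^esub> ext p" if "q \<in> A.B #>\<^bsub>A.G\<^esub> p" for q
    by (rule A.hom_coset_const[OF ext_hom B.T.is_group ext_relator assms that])
  moreover have "p \<in> A.B #>\<^bsub>A.G\<^esub> p"
    by (rule A.G.rcos_self[OF assms A.subgroup_balanced])
  ultimately show ?thesis
    unfolding tensor_map_def by (fold ext_def) blast
qed

lemma tensor_map_pure: "a \<in> carrier A \<Longrightarrow> tensor_map B T \<sigma> \<phi> (A.pure a m) = B.pure (\<phi> a) m"
  unfolding A.pure_eq B.pure_eq by (subst tensor_map_coset) (auto simp: ext_def)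

lemma tensor_map_hom: "tensor_map B T \<sigma> \<phi> \<in> hom A.T B.T"
proof (rule homI)
  fix x y assume "x \<in> carrier A.T" "y \<in> carrier A.T"
  then obtain p q where "p \<in> carrier A.G" "q \<in> carrier A.G" "x = A.B #>\<^bsub>A.G\<^esub> p" "y = A.B #>\<^bsub>A.G\<^esub> q"
    unfolding tensor_def carrier_FactGroup by blast
  then show "tensor_map B T \<sigma> \<phi> x \<in> carrier B.T"
    and "tensor_map B T \<sigma> \<phi> (x \<otimes>\<^bsub>A.T\<^esub> y) = tensor_map B T \<sigma> \<phi> x \<otimes>\<^bsub>B.T\<^esub> tensor_map B T \<sigma> \<phi> y"
    using hom_mult[OF ext_hom] A.add_closed_G
    by (auto simp: tensor_map_coset B.coset_closed ext_closed simp del: A.G_simps(1) B.G_simps(1)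
        simp flip: A.coset_add)
qed

end


subsection \<open>Signed permutations and divided differences\<close>

lemma yconst_simps: "yconst (a + b) = yconst a + yconst b" "yconst (a * b) = yconst a * yconst b"
    "yconst 1 = 1" "yconst 0 = 0" "yconst (- a) = - yconst a"
  by (simp_all add: yconst_def single_add mult_single single_uminus)

lemma ypoly_induct [case_names const var add]:
  fixes f :: "'n ypoly"
  assumes const: "\<And>a. P (yconst a)" and var: "\<And>j f. P f \<Longrightarrow> P (yvar j * f)"
    and add: "\<And>f g. P f \<Longrightarrow> P g \<Longrightarrow> P (f + g)"
  shows "P f"
proof (induction f rule: poly_mapping_add_induct)
  case (single \<alpha> a)
  \<comment> \<open>Generalising from a monomial to a monomial times any \<open>f\<close> with
    \<open>P f\<close> lets the exponent be split additively, one factor being applied after the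
    other.\<close>
  have "\<forall>f. P f \<longrightarrow> P (Poly_Mapping.single \<alpha> 1 * f)"
  proof (induction \<alpha> rule: poly_mapping_add_induct)
    case (single j n)
    show ?case
    proof (induction n)
      case (Suc n)
      have "Poly_Mapping.single (Poly_Mapping.single j (Suc n)) 1 =
          yvar j * (Poly_Mapping.single (Poly_Mapping.single j n) 1 :: 'n ypoly)"
        by (simp add: yvar_def mult_single flip: single_add)
      then show ?case using Suc var by (simp add: mult.assoc)
    qed simp
  next
    case (add \<alpha> \<beta>)
    have "Poly_Mapping.single (\<alpha> + \<beta>) 1 =
        (Poly_Mapping.single \<alpha> 1 * Poly_Mapping.single \<beta> 1 :: 'n ypoly)"
      by (simp add: mult_single)
    then show ?case using add by (simp add: mult.assoc)
  qed
  then have "P (Poly_Mapping.single \<alpha> 1 * yconst a)"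
    using const by blast
  then show ?case by (simp add: yconst_def mult_single)
qed (rule add)

lemma yact_psum: "yact w = psum (\<lambda>\<alpha> a. yconst a *
    (\<Prod>i\<in>UNIV. (of_int (sgn_at w i) * yvar (prm w i)) ^ Poly_Mapping.lookup \<alpha> i))"
  by (rule ext) (simp add: yact_def psum_def)

lemma yact_single: "yact w (Poly_Mapping.single \<alpha> a) = yconst a *
    (\<Prod>i\<in>UNIV. (of_int (sgn_at w i) * yvar (prm w i)) ^ Poly_Mapping.lookup \<alpha> i)"
  by (simp add: yact_psum psum_single yconst_simps)

lemma yact_const [simp]: "yact w (yconst a) = yconst a"
  by (simp add: yconst_def[of a] yact_single)

interpretation yact: unital_hom "yact w"
proof
  show add: "yact w (f + g) = yact w f + yact w g" for f g
    unfolding yact_psum by (rule psum_add) (simp add: yconst_simps algebra_simps)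
  show "yact w (f * g) = yact w f * yact w g" for f g
  proof (induction f rule: poly_mapping_add_induct)
    case (single \<alpha> a)
    show ?case
      by (induction g rule: poly_mapping_add_induct)
        (simp_all add: mult_single yact_single yconst_simps lookup_add power_add prod.distrib
          add distrib_left mult.assoc mult.left_commute)
  qed (simp add: add distrib_right)
  show "yact w 1 = 1"
    using yact_const[of w 1] by (simp add: yconst_simps)
qed

lemma yact_var [simp]: "yact w (yvar j) = of_int (sgn_at w j) * yvar (prm w j)"
proof -
  have "(\<Prod>i\<in>UNIV. (of_int (sgn_at w i) * yvar (prm w i)) ^ Poly_Mapping.lookup (Poly_Mapping.single j 1) i) =
      (\<Prod>i\<in>UNIV. if j = i then of_int (sgn_at w i) * yvar (prm w i) else 1)"
    by (rule prod.cong) (auto simp: lookup_single when_def)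
  then show ?thesis
    by (simp add: yvar_def[of j] yact_single yconst_simps)
qed

lemma of_int_ypoly: "(of_int e :: 'n ypoly) = yconst (of_int e)"
  by (simp add: yconst_def)

lemma yact_of_int [simp]: "yact w (of_int e) = of_int e"
  unfolding of_int_ypoly by simp

lemma yact_one [simp]: "yact 1 f = f"
  by (induction f rule: ypoly_induct) (simp_all add: yact.hom_add yact.hom_mult)

lemma yact_times: "yact (w * w') f = yact w (yact w' f)"
  by (induction f rule: ypoly_induct) (simp_all add: yact.hom_add yact.hom_mult mult.assoc)

lemma sinv_right: "w * sinv w = (1 :: 'n sperm)"
  by (metis sinv_left mult.assoc mult.right_neutral mult.left_neutral)

lemma yact_sinv [simp]: "yact w (yact (sinv w) f) = f" "yact (sinv w) (yact w f) = f"
  by (simp_all add: sinv_left sinv_right flip: yact_times)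

definition dd :: "'n::finite sperm \<Rightarrow> 'n ypoly \<Rightarrow> 'n ypoly \<Rightarrow> 'n ypoly" where
  "dd w r f = yquot (f - yact w f) r"

text \<open>The reflection formula w(y) = y - \<beta>(y) r on the variables, \<open>\<beta>\<close>
  being the coroot. Divisibility of all differences by \<open>r\<close> follows from it.\<close>

locale root =
  fixes w :: "'n::{finite, linorder} sperm" and r :: "'n ypoly" and \<beta> :: "'n \<Rightarrow> complex"
  assumes root_nonzero: "r \<noteq> 0"
    and root_var: "yvar j - yact w (yvar j) = yconst (\<beta> j) * r"
begin

lemma ddI: "q * r = f - yact w f \<Longrightarrow> dd w r f = q"
  unfolding dd_def yquot_def
  by (rule the_equality) (metis mult_right_cancel root_nonzero)+

text \<open>Twisted Leibniz rule: y f - w(y f) = y (f - w(f)) + (y - w(y)) w(f). For a variable y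
  the second term is a constant times r w(f), which gives the witness for
  \<open>yvar j * f\<close>.\<close>

lemma dd_exists: "\<exists>q. q * r = f - yact w f"
proof (induction f rule: ypoly_induct)
  case (const a)
  show ?case by (rule exI[of _ 0]) simp
next
  case (var j f)
  then obtain q where q: "q * r = f - yact w f" by blast
  have "(yvar j * q + yconst (\<beta> j) * yact w f) * r =
      yvar j * (f - yact w f) + (yvar j - yact w (yvar j)) * yact w f"
    unfolding root_var by (simp add: algebra_simps flip: q)
  also have "\<dots> = yvar j * f - yact w (yvar j * f)"
    by (simp add: yact.hom_mult algebra_simps)
  finally show ?case by blast
next
  case (add f g)
  then obtain q q' where "q * r = f - yact w f" "q' * r = g - yact w g" by blast
  then have "(q + q') * r = f + g - yact w (f + g)"
    by (simp add: yact.hom_add distrib_right)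
  then show ?case by blast
qed

lemma dd_mult_root: "dd w r f * r = f - yact w f"
  using dd_exists[of f] ddI by blast

lemma dd_add: "dd w r (f + g) = dd w r f + dd w r g"
  by (rule ddI) (simp add: dd_mult_root yact.hom_add distrib_right)

lemma dd_scale: "dd w r (yconst a * f) = yconst a * dd w r f"
  by (rule ddI) (simp add: mult.assoc dd_mult_root yact.hom_mult right_diff_distrib)

lemma dd_one: "dd w r 1 = 0"
  by (rule ddI) simp

lemma dd_var: "dd w r (yvar j * f) = yvar j * dd w r f + yconst (\<beta> j) * yact w f"
proof (rule ddI)
  have "(yvar j * dd w r f + yconst (\<beta> j) * yact w f) * r =
      yvar j * (f - yact w f) + (yvar j - yact w (yvar j)) * yact w f"
    unfolding root_var by (simp add: algebra_simps flip: dd_mult_root)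
  then show "(yvar j * dd w r f + yconst (\<beta> j) * yact w f) * r = yvar j * f - yact w (yvar j * f)"
    by (simp add: yact.hom_mult algebra_simps)
qed

end

text \<open>Applying \<open>s\<close> to the defining equation of the quotient by \<open>r\<close>
  gives one for the quotient by \<open>r'\<close>, and quotients are unique. The sign
  \<open>e\<close> records that \<open>s\<close> may send \<open>r\<close> to the negative of the
  root chosen for \<open>w'\<close>.\<close>

lemma dd_conj:
  assumes "root w r \<beta>" "root w' r' \<beta>'" and conj: "s * w = w' * s"
    and r: "yact s r = of_int e * r'" and e: "e = 1 \<or> e = -1"
  shows "yact s (dd w r (yact (sinv s) f)) = of_int e * dd w' r' f"
proof -
  interpret w: root w r \<beta> by fact
  interpret w': root w' r' \<beta>' by fact
  have "of_int e * yact s (dd w r (yact (sinv s) f)) * r' = yact s (dd w r (yact (sinv s) f) * r)"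
    by (simp add: yact.hom_mult r)
  also have "\<dots> = f - yact (s * w * sinv s) f"
    by (simp add: w.dd_mult_root yact.hom_diff yact_times)
  also have "s * w * sinv s = w'"
    by (simp add: conj mult.assoc sinv_right)
  finally have "dd w' r' f = of_int e * yact s (dd w r (yact (sinv s) f))"
    by (rule w'.ddI)
  then show ?thesis using e by auto
qed

definition sw :: "bool \<Rightarrow> 'n \<Rightarrow> 'n \<Rightarrow> 'n sperm" where
  "sw b k i = (if b then swp k i else swp_neg k i)"

text \<open>Normalised to have coefficient 1 at \<open>yvar i\<close>, where i is the index of the
  Dunkl operator. Hence \<open>rt True k i\<close> changes sign when k and i are exchanged, although
  \<open>sw True k i\<close> does not.\<close>

definition rt :: "bool \<Rightarrow> 'n \<Rightarrow> 'n \<Rightarrow> 'n ypoly" where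
  "rt b k i = (if b then yvar i - yvar k else yvar i + yvar k)"

text \<open>The coefficient of y_j in \<open>rt b k i\<close>. These roots have squared length 2, so
  it is also the value of the coroot on y_j.\<close>

definition rt_coeff :: "bool \<Rightarrow> 'n \<Rightarrow> 'n \<Rightarrow> 'n \<Rightarrow> complex" where
  "rt_coeff b k i j = (if j = i then 1 else if j = k then (if b then -1 else 1) else 0)"

lemma lookup_yvar: "Poly_Mapping.lookup (yvar j) (Poly_Mapping.single i 1) = (if i = j then 1 else 0)"
proof -
  have "Poly_Mapping.single j (1 :: nat) = Poly_Mapping.single i 1 \<longleftrightarrow> i = j"
    by (metis lookup_single_eq lookup_single_not_eq zero_neq_one)
  then show ?thesis by (simp add: yvar_def lookup_single when_def)
qed

lemma root_sw:
  fixes i k :: "'n::{finite, linorder}"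
  assumes "k \<noteq> i"
  shows "root (sw b k i) (rt b k i) (rt_coeff b k i)"
proof
  \<comment> \<open>The linear coefficient at y_i is 1 because k and i differ, which shows that the
    root is nonzero.\<close>
  have "Poly_Mapping.lookup (rt b k i) (Poly_Mapping.single i 1) = 1"
    using assms by (simp add: rt_def lookup_add lookup_minus lookup_yvar del: One_nat_def)
  then show "rt b k i \<noteq> 0" by (metis lookup_zero zero_neq_one)
  show "yvar j - yact (sw b k i) (yvar j) = yconst (rt_coeff b k i j) * rt b k i" for j
    using assms by (auto simp: sw_def rt_def rt_coeff_def yconst_simps transpose_def)
qed

text \<open>With the divisor 2 y_i the coroot value at y_i is 1, so that the commutator of y_i with
  this divided difference is exactly minus the sign change, as the term with sqrt 2 v
  requires.\<close>

lemma root_neg_at: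
  fixes i :: "'n::{finite, linorder}"
  shows "root (neg_at i) (2 * yvar i) (\<lambda>j. if j = i then 1 else 0)"
proof
  have "Poly_Mapping.lookup (2 * yvar i) (Poly_Mapping.single i 1) = 2"
    unfolding mult_2 lookup_add lookup_yvar by simp
  then show "2 * yvar i \<noteq> 0" by (metis lookup_zero zero_neq_numeral)
qed (auto simp: yconst_simps)

lemma prm_eq_iff [simp]: "prm w x = prm w y \<longleftrightarrow> x = y"
  using sperm_props(1)[of w] by (auto simp: bij_def inj_eq)

lemma sw_sel:
  "prm (sw b k i) = transpose k i"
  "sgn_at (sw b k i) x = (if \<not> b \<and> (x = k \<or> x = i) then -1 else 1)"
  by (simp_all add: sw_def)

text \<open>Conjugation exchanges the two kinds of swaps exactly when \<open>w\<close> has different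
  signs at k and i; the equation of truth values \<open>b = (sgn_at w k = sgn_at w i)\<close>
  negates \<open>b\<close> in precisely that case.\<close>

lemma sw_conj:
  "w * sw b k i = sw (b = (sgn_at w k = sgn_at w i)) (prm w k) (prm w i) * w"
proof (rule sperm_eqI)
  show "prm (w * sw b k i) = prm (sw (b = (sgn_at w k = sgn_at w i)) (prm w k) (prm w i) * w)"
    by (simp add: sw_sel fun_eq_iff transpose_def)
  have "sgn_at w k = 1 \<or> sgn_at w k = -1" "sgn_at w i = 1 \<or> sgn_at w i = -1"
    by (rule sperm_props)+
  then have "sgn_at (w * sw b k i) x = sgn_at (sw (b = (sgn_at w k = sgn_at w i)) (prm w k) (prm w i) * w) x" for x
    by (cases "x = k"; cases "x = i"; elim disjE) (simp_all add: sw_sel)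
  then show "sgn_at (w * sw b k i) = sgn_at (sw (b = (sgn_at w k = sgn_at w i)) (prm w k) (prm w i) * w)"
    by (rule ext)
qed

lemma neg_at_conj: "w * neg_at i = neg_at (prm w i) * w"
proof (rule sperm_eqI)
  show "sgn_at (w * neg_at i) = sgn_at (neg_at (prm w i) * w)"
    using sperm_props(1)[of w] by (auto simp: bij_def inj_eq)
qed simp

lemma rt_conj:
  "yact w (rt b k i) = of_int (sgn_at w i) * rt (b = (sgn_at w k = sgn_at w i)) (prm w k) (prm w i)"
  using sperm_props(2)[of w k] sperm_props(2)[of w i]
  by (auto simp: rt_def yact.hom_diff yact.hom_add)


subsection \<open>Dunkl operators\<close>

lemma app_simps [simp]:
  "app (S + T) x = app S x + app T x" "app (S - T) x = app S x - app T x" "app (- T) x = - app T x"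
  "app 0 x = 0" "app 1 x = x" "app (S * T) x = app S (app T x)"
  by (transfer, simp)+

lemma app_sum_endo: "app (sum F A) x = (\<Sum>a\<in>A. app (F a) x)"
  by (induction A rule: infinite_finite_induct) simp_all

definition ylin :: "('n ypoly \<Rightarrow> 'n ypoly) \<Rightarrow> bool" where
  "ylin T \<longleftrightarrow> (\<forall>f g. T (f + g) = T f + T g) \<and> (\<forall>a f. T (yconst a * f) = yconst a * T f)"

lemma ylin_add: "ylin T \<Longrightarrow> T (f + g) = T f + T g"
  and ylin_scale: "ylin T \<Longrightarrow> T (yconst a * f) = yconst a * T f"
  by (simp_all add: ylin_def)

lemma ylin_id: "ylin (\<lambda>f. f)"
  and ylin_yact: "ylin (yact w)"
  and ylin_var: "ylin (\<lambda>f. yvar j * f)"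
  and ylin_comp: "ylin T \<Longrightarrow> ylin T' \<Longrightarrow> ylin (\<lambda>f. T (T' f))"
  by (simp_all add: ylin_def yact.hom_add yact.hom_mult distrib_left mult.left_commute)

lemma (in root) ylin_dd: "ylin (dd w r)"
  by (simp add: ylin_def dd_add dd_scale)

section \<open>Clifford elements attached to the swaps\<close>

definition ke :: "bool \<Rightarrow> 'n \<Rightarrow> 'n \<Rightarrow> 'n kgen free_alg" where
  "ke b k i = (if b then 1 + kc k * kc i else 1 - kc k * kc i) * kg (sw b k i)"

lemma swp_commute: "swp i j = swp j i" "swp_neg i j = swp_neg j i"
  by (rule sperm_eqI; auto simp: transpose_commute)+


text \<open>From aba = -b and bab = -a, both sides of the four equations reduce to (a - b)s, (a +
  b)s, -(a + b)t and (a - b)t. With a = c_k and b = c_i this is why each summand of the Dunkl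
  operator for i anticommutes with c_i and commutes with c_k.\<close>

lemma swap_clifford:
  fixes a b s t :: "'r::{ring, monoid_mult}"
  assumes "a * a = 1" "b * b = 1" "a * b = - (b * a)"
    and "s * b = a * s" "s * a = b * s" "t * b = - (a * t)" "t * a = - (b * t)"
  shows "(1 + a * b) * s * b = - (b * ((1 + a * b) * s))" "(1 + a * b) * s * a = a * ((1 + a * b) * s)"
    "(1 - a * b) * t * b = - (b * ((1 - a * b) * t))" "(1 - a * b) * t * a = a * ((1 - a * b) * t)"
proof -
  \<comment> \<open>Each two-letter rule also has to fire inside a right-nested product;
    \<open>l\<close> supplies that variant.\<close>
  have l: "x * (y * z) = w * z" if "x * y = w" for x y z w :: 'r
    using that by (simp flip: mult.assoc)
  note rules = assms assms[THEN l]
  show "(1 + a * b) * s * b = - (b * ((1 + a * b) * s))" "(1 + a * b) * s * a = a * ((1 + a * b) * s)"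
    "(1 - a * b) * t * b = - (b * ((1 - a * b) * t))" "(1 - a * b) * t * a = a * ((1 - a * b) * t)"
    by (simp_all add: rules distrib_left distrib_right left_diff_distrib right_diff_distrib mult.assoc)
qed

text \<open>Since c anticommutes with both a and b, it commutes with ab.\<close>

lemma other_clifford:
  fixes a b c s :: "'r::{ring, monoid_mult}"
  assumes "a * c = - (c * a)" "b * c = - (c * b)" "s * c = c * s"
  shows "(1 + a * b) * s * c = c * ((1 + a * b) * s)" "(1 - a * b) * s * c = c * ((1 - a * b) * s)"
proof -
  have l: "x * (y * z) = w * z" if "x * y = w" for x y z w :: 'r
    using that by (simp flip: mult.assoc)
  note rules = assms assms[THEN l]
  show "(1 + a * b) * s * c = c * ((1 + a * b) * s)" "(1 - a * b) * s * c = c * ((1 - a * b) * s)"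
    by (simp_all add: rules distrib_left distrib_right left_diff_distrib right_diff_distrib mult.assoc)
qed

text \<open>Both sides have the normal form (1 - ab)xs - (1 + ab)ys - (1 + ab)xt - (1 - ab)yt. The
  letters x and y will be two Dunkl operators, a and b the Clifford generators with the same
  indices, s and t the two swaps of these indices.\<close>

lemma dunkl_pair:
  fixes x y a b s t :: "'r::{ring, monoid_mult}"
  assumes "x * a = - (a * x)" "x * b = b * x" "y * b = - (b * y)" "y * a = a * y"
    and "a * b = - (b * a)" "s * x = y * s" "s * y = x * s" "t * x = - (y * t)" "t * y = - (x * t)"
  shows "x * ((1 + a * b) * s - (1 - a * b) * t) - ((1 + a * b) * s - (1 - a * b) * t) * x =
    ((1 + b * a) * s + (1 - b * a) * t) * y - y * ((1 + b * a) * s + (1 - b * a) * t)"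
proof -
  have l: "x * (y * z) = w * z" if "x * y = w" for x y z w :: 'r
    using that by (simp flip: mult.assoc)
  note rules = assms assms[THEN l]
  show ?thesis
    by (simp add: rules distrib_left distrib_right left_diff_distrib right_diff_distrib mult.assoc)
qed

section \<open>The model of C[y] (x) M and the operators on it\<close>

locale K_module =
  fixes act :: "'n::{finite, linorder} kgen free_alg set \<Rightarrow> 'm::ab_group_add \<Rightarrow> 'm"
    and u v :: complex
  assumes left_module: "left_module K_alg act"
begin

sublocale M: left_module K_alg act
  by (rule left_module)

definition kop :: "'n kgen free_alg \<Rightarrow> 'm endo" where
  "kop a = Endo (act (kcls a))"

lemma kcls_closed: "kcls a \<in> carrier K_alg"
  by (simp add: K_alg_def kcls_def)

lemma app_kop: "app (kop a) = act (kcls a)"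
  unfolding kop_def by (rule app_Endo) (rule M.act_add_right[OF kcls_closed])

sublocale kop: unital_hom kop
proof
  show "kop (a + b) = kop a + kop b" "kop (a * b) = kop a * kop b" "kop 1 = 1" for a b
    using M.act_add_left[OF kcls_closed[of a] kcls_closed[of b]]
      M.act_mult[OF kcls_closed[of a] kcls_closed[of b]] M.act_one
    by (auto intro!: endo_eqI simp: app_kop K_alg_def kcls_def cls_add cls_mult cls_one)
qed

lemma kop_rel: "a - b \<in> K_rels kc kg \<Longrightarrow> kop a = kop b"
  unfolding kop_def kcls_def by (simp add: cls_relI)

lemma kop_rels:
  "kop (kc i) * kop (kc i) = 1"
  "i \<noteq> j \<Longrightarrow> kop (kc i) * kop (kc j) = - (kop (kc j) * kop (kc i))"
  "kop (kg 1) = 1"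
  "kop (kg w) * kop (kg w') = kop (kg (w * w'))"
  "kop (kg w) * kop (kc i) * kop (kg (sinv w)) =
     (if sgn_at w i = 1 then kop (kc (prm w i)) else - kop (kc (prm w i)))"
proof -
  have "kop (kc i * kc i) = kop 1" "i \<noteq> j \<Longrightarrow> kop (kc i * kc j) = kop (- (kc j * kc i))"
    "kop (kg 1) = kop 1" "kop (kg w * kg w') = kop (kg (w * w'))"
    "kop (kg w * kc i * kg (sinv w)) = kop (of_int (sgn_at w i) * kc (prm w i))"
    by (rule kop_rel; simp add: K_rels_def; blast)+
  then show "kop (kc i) * kop (kc i) = 1"
    "i \<noteq> j \<Longrightarrow> kop (kc i) * kop (kc j) = - (kop (kc j) * kop (kc i))"
    "kop (kg 1) = 1"
    "kop (kg w) * kop (kg w') = kop (kg (w * w'))"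
    "kop (kg w) * kop (kc i) * kop (kg (sinv w)) =
     (if sgn_at w i = 1 then kop (kc (prm w i)) else - kop (kc (prm w i)))"
    unfolding hom_sign[OF kop.unital_hom_axioms sperm_props(2)] by (simp_all add: kop.hom_simps)
qed

lemma kop_gc:
  "kop (kg w) * kop (kc i) =
     (if sgn_at w i = 1 then kop (kc (prm w i)) else - kop (kc (prm w i))) * kop (kg w)"
proof -
  have "kop (kg w) * kop (kc i) = kop (kg w) * kop (kc i) * kop (kg (sinv w)) * kop (kg w)"
    by (simp only: mult.assoc kop_rels(4) sinv_left kop_rels(3) mult_1_right)
  then show ?thesis by (simp only: kop_rels(5))
qed

text \<open>The model of \<open>\<complex>[y\<^sub>1, \<dots>, y\<^sub>n] \<otimes> M\<close> is the group of finitely supported families of elements of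
  \<open>M\<close> indexed by the monomials; \<open>tm f m\<close> stands for \<open>f \<otimes> m\<close>.\<close>

definition tm :: "'n ypoly \<Rightarrow> 'm \<Rightarrow> (('n \<Rightarrow>\<^sub>0 nat) \<Rightarrow>\<^sub>0 'm)" where
  "tm f m = psum (\<lambda>\<alpha> a. Poly_Mapping.single \<alpha> (app (kop (scal a)) m)) f"

lemma tm_add_left: "tm (f + g) m = tm f m + tm g m"
  unfolding tm_def by (rule psum_add) (simp add: scal_simps kop.hom_add single_add)

lemma tm_add_right: "tm f (m + m') = tm f m + tm f m'"
  unfolding tm_def psum_def by (simp add: single_add sum.distrib)

lemma tm_zero [simp]: "tm 0 m = 0" "tm f 0 = 0"
  using tm_add_left[of 0 0 m] tm_add_right[of f 0 0] by simp_all

lemma tm_uminus: "tm (- f) m = - tm f m" "tm f (- m) = - tm f m"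
  using tm_add_left[of f "- f" m] tm_add_right[of f m "- m"]
  by (simp_all add: minus_unique[symmetric])

lemma tm_single: "tm (Poly_Mapping.single \<alpha> a) m = Poly_Mapping.single \<alpha> (app (kop (scal a)) m)"
proof -
  have "scal 0 = (0 :: 'n kgen free_alg)" by (simp add: scal_def)
  then show ?thesis unfolding tm_def by (simp add: psum_single)
qed

lemma single_tm: "Poly_Mapping.single \<alpha> m = tm (Poly_Mapping.single \<alpha> 1) m"
  by (simp add: tm_single scal_simps)

lemma tm_one: "tm 1 m = Poly_Mapping.single 0 m"
  by (simp add: single_tm)

lemma tm_scale: "tm (yconst a * f) m = tm f (app (kop (scal a)) m)"
proof (induction f rule: poly_mapping_add_induct)
  case (single \<alpha> b)
  have "kop (scal (a * b)) = kop (scal b) * kop (scal a)"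
    by (simp add: scal_simps kop.hom_mult flip: kop.hom_mult scal_simps) (simp add: mult.commute)
  then show ?case by (simp add: yconst_def mult_single tm_single)
qed (simp add: distrib_left tm_add_left)

lemma kop_scal_commute: "kop x * kop (scal a) = kop (scal a) * kop x"
  by (simp add: scal_commute flip: kop.hom_mult)

text \<open>The operator T (x) x, prescribed on monomials so that it is additive for every
  \<open>T\<close>. It has the expected value on \<open>tm f m\<close> for general f once
  \<open>T\<close> is complex linear, whence the assumptions \<open>ylin\<close>.\<close>

definition oper :: "('n ypoly \<Rightarrow> 'n ypoly) \<Rightarrow> 'n kgen free_alg \<Rightarrow> (('n \<Rightarrow>\<^sub>0 nat) \<Rightarrow>\<^sub>0 'm) endo" where
  "oper T x = Endo (psum (\<lambda>\<alpha> m. tm (T (Poly_Mapping.single \<alpha> 1)) (app (kop x) m)))"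

lemma app_oper: "app (oper T x) = psum (\<lambda>\<alpha> m. tm (T (Poly_Mapping.single \<alpha> 1)) (app (kop x) m))"
  unfolding oper_def by (rule app_Endo, rule psum_add) (simp add: tm_add_right)

lemma oper_tm:
  assumes T: "ylin T"
  shows "app (oper T x) (tm f m) = tm (T f) (app (kop x) m)"
proof (induction f rule: poly_mapping_add_induct)
  case (single \<alpha> a)
  have "app (oper T x) (tm (Poly_Mapping.single \<alpha> a) m) =
      tm (T (Poly_Mapping.single \<alpha> 1)) (app (kop x * kop (scal a)) m)"
    by (simp add: tm_single app_oper psum_single)
  also have "\<dots> = tm (yconst a * T (Poly_Mapping.single \<alpha> 1)) (app (kop x) m)"
    by (simp add: kop_scal_commute tm_scale)
  also have "\<dots> = tm (T (Poly_Mapping.single \<alpha> a)) (app (kop x) m)"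
    using ylin_scale[OF T, of a "Poly_Mapping.single \<alpha> 1"] by (simp add: yconst_def mult_single)
  finally show ?case .
qed (simp add: tm_add_left ylin_add[OF T])

lemma N_eqI:
  fixes S T :: "(('n \<Rightarrow>\<^sub>0 nat) \<Rightarrow>\<^sub>0 'm) endo"
  assumes "\<And>f m. app S (tm f m) = app T (tm f m)"
  shows "S = T"
proof (rule endo_eqI)
  fix p show "app S p = app T p"
    by (induction p rule: poly_mapping_add_induct) (simp_all add: single_tm assms)
qed

lemma oper_mult: "ylin T \<Longrightarrow> ylin T' \<Longrightarrow> oper T x * oper T' x' = oper (\<lambda>f. T (T' f)) (x * x')"
  by (rule N_eqI) (simp add: oper_tm ylin_comp kop.hom_mult)

lemma oper_add: "ylin T \<Longrightarrow> oper T (x + x') = oper T x + oper T x'"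
  by (rule N_eqI) (simp add: oper_tm kop.hom_add tm_add_right)

lemma oper_uminus: "ylin T \<Longrightarrow> oper T (- x) = - oper T x"
  by (rule N_eqI) (simp add: oper_tm kop.hom_uminus tm_uminus)

lemma oper_diff: "ylin T \<Longrightarrow> oper T (x - x') = oper T x - oper T x'"
  using oper_add[of T x "- x'"] by (simp add: oper_uminus)

lemma oper_one: "oper (\<lambda>f. f) 1 = 1"
  by (rule N_eqI) (simp add: oper_tm ylin_id)

lemma oper_cong: "kop x = kop x' \<Longrightarrow> oper T x = oper T x'"
  by (simp add: oper_def)

text \<open>The images of \<open>c\<^sub>i\<close>, \<open>w\<close>, \<open>y\<^sub>j\<close>, the scalars and \<open>x\<^sub>i\<close> are \<open>C\<close>, \<open>G\<close>, \<open>Y\<close>, \<open>Sc\<close> and the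
  Dunkl operators \<open>D\<close>. The flag \<open>b\<close> selects between the swap of
  \<open>k, i\<close> and the swap with signs.\<close>

definition "C i = oper (\<lambda>f. f) (kc i)"
definition "G w = oper (yact w) (kg w)"
definition "Y j = oper (\<lambda>f. yvar j * f) 1"
definition "Sc a = oper (\<lambda>f. f) (scal a)"
definition "E b k i = oper (dd (sw b k i) (rt b k i)) (ke b k i)"
definition "F i = oper (dd (neg_at i) (2 * yvar i)) (kg (neg_at i))"
definition "D i = Sc u * (\<Sum>k\<in>UNIV - {i}. E True k i + E False k i) +
  Sc (complex_of_real (sqrt 2) * v) * F i"
text \<open>The image of a Clifford-times-swap term in the relations for [y_j, x_i]. By
  \<open>P_eq\<close> it differs from \<open>E\<close> only in that the swap itself replaces its
  divided difference.\<close>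

definition "P b k i = (if b then 1 + C k * C i else 1 - C k * C i) * G (sw b k i)"

lemmas ylin_intros = ylin_id ylin_yact ylin_var ylin_comp root.ylin_dd[OF root_sw] root.ylin_dd[OF root_neg_at]

lemma CC: "C i * C i = 1" "i \<noteq> j \<Longrightarrow> C i * C j = - (C j * C i)"
  and G_one: "G 1 = 1" and GG: "G w * G w' = G (w * w')"
  and GC: "G w * C i = (if sgn_at w i = 1 then C (prm w i) else - C (prm w i)) * G w"
  and YY: "Y i * Y j = Y j * Y i" and YC: "Y i * C j = C j * Y i"
  and GY: "G w * Y i = (if sgn_at w i = 1 then Y (prm w i) else - Y (prm w i)) * G w"
proof -
  show "C i * C i = 1"
    by (simp add: C_def oper_mult ylin_id oper_cong[of "kc i * kc i" 1] kop.hom_mult kop_rels oper_one)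
  show "C i * C j = - (C j * C i)" if "i \<noteq> j"
    using that
    by (simp add: C_def oper_mult ylin_id oper_cong[of "kc i * kc j" "- (kc j * kc i)"]
        kop.hom_simps kop_rels(2)[of i j] oper_uminus)
  show "G 1 = 1"
    by (rule N_eqI) (simp add: G_def oper_tm ylin_yact kop_rels)
  have "app (kop (kg w)) (app (kop (kg w')) m) = app (kop (kg (w * w'))) m" for m
    by (simp flip: kop_rels(4))
  then show "G w * G w' = G (w * w')"
    by (intro N_eqI) (simp add: G_def oper_tm ylin_yact yact_times)
  have "app (kop (kg w)) (app (kop (kc i)) m) =
      app ((if sgn_at w i = 1 then kop (kc (prm w i)) else - kop (kc (prm w i))) * kop (kg w)) m" for m
    by (simp flip: kop_gc)
  then show "G w * C i = (if sgn_at w i = 1 then C (prm w i) else - C (prm w i)) * G w"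
    by (intro N_eqI) (simp add: C_def G_def oper_tm ylin_intros tm_uminus)
  show "Y i * Y j = Y j * Y i" "Y i * C j = C j * Y i"
    by (rule N_eqI; simp add: Y_def C_def oper_tm ylin_intros mult.left_commute)+
  show "G w * Y i = (if sgn_at w i = 1 then Y (prm w i) else - Y (prm w i)) * G w"
    using sperm_props(2)[of w i]
    by (intro N_eqI) (auto simp: Y_def G_def oper_tm ylin_intros yact.hom_mult tm_uminus)
qed


sublocale Sc: unital_hom Sc
  by standard (simp_all add: Sc_def scal_simps oper_add oper_mult oper_one ylin_id)

lemma kop_scal_app: "app (kop (scal a)) (app (kop x) m) = app (kop x) (app (kop (scal a)) m)"
  by (simp add: kop_scal_commute flip: app_simps(6))

lemma Sc_commute: "ylin T \<Longrightarrow> Sc a * oper T x = oper T x * Sc a"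
  by (rule N_eqI) (simp add: Sc_def oper_tm ylin_id kop_scal_app)

lemma Sc_Y: "Sc a * Y j = Y j * Sc a" and Sc_C: "Sc a * C j = C j * Sc a"
  and Sc_G: "Sc a * G w = G w * Sc a" and Sc_E: "k \<noteq> i \<Longrightarrow> Sc a * E b k i = E b k i * Sc a"
  and Sc_F: "Sc a * F i = F i * Sc a"
  unfolding Y_def C_def G_def E_def F_def by (rule Sc_commute; simp add: ylin_intros)+

section \<open>Commutators of the variables with the Dunkl operators\<close>

lemma P_eq: "P b k i = oper (yact (sw b k i)) (ke b k i)"
proof -
  have "1 + C k * C i = oper (\<lambda>f. f) (1 + kc k * kc i)" "1 - C k * C i = oper (\<lambda>f. f) (1 - kc k * kc i)"
    by (simp_all add: C_def oper_mult oper_add oper_diff oper_one ylin_id)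
  then show ?thesis
    by (simp add: P_def G_def oper_mult ylin_intros ke_def)
qed

text \<open>In the twisted Leibniz rule the term y_j times the divided difference cancels in the
  commutator; only the reflection with weight \<open>\<beta> j\<close> remains.\<close>

lemma Y_oper_dd:
  assumes "root w r \<beta>"
  shows "Y j * oper (dd w r) x - oper (dd w r) x * Y j = - (Sc (\<beta> j) * oper (yact w) x)"
proof -
  interpret root w r \<beta> by fact
  show ?thesis
    by (rule N_eqI)
      (simp add: Y_def Sc_def oper_tm ylin_intros ylin_dd dd_var tm_add_left tm_scale kop_scal_app)
qed

lemma YE: "k \<noteq> i \<Longrightarrow> Y j * E b k i - E b k i * Y j = - (Sc (rt_coeff b k i j) * P b k i)"
  unfolding E_def P_eq by (rule Y_oper_dd[OF root_sw])

lemma YF: "Y j * F i - F i * Y j = - (Sc (if j = i then 1 else 0) * G (neg_at i))"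
  unfolding F_def G_def by (rule Y_oper_dd[OF root_neg_at])

lemma YD: "Y j * D i - D i * Y j =
  - (Sc u * (\<Sum>k\<in>UNIV - {i}. Sc (rt_coeff True k i j) * P True k i + Sc (rt_coeff False k i j) * P False k i))
  - Sc (complex_of_real (sqrt 2) * v) * (Sc (if j = i then 1 else 0) * G (neg_at i))"
proof -
  have comm: "Y j * (Sc a * z) - Sc a * z * Y j = Sc a * (Y j * z - z * Y j)" for a z
    by (simp add: right_diff_distrib mult.assoc) (simp add: Sc_Y flip: mult.assoc)
  have "Y j * D i - D i * Y j =
      Sc u * (Y j * (\<Sum>k\<in>UNIV - {i}. E True k i + E False k i) - (\<Sum>k\<in>UNIV - {i}. E True k i + E False k i) * Y j) +
      Sc (complex_of_real (sqrt 2) * v) * (Y j * F i - F i * Y j)"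
    unfolding D_def by (simp add: distrib_left distrib_right flip: comm)
  also have "Y j * (\<Sum>k\<in>UNIV - {i}. E True k i + E False k i) - (\<Sum>k\<in>UNIV - {i}. E True k i + E False k i) * Y j =
      (\<Sum>k\<in>UNIV - {i}. (Y j * E True k i - E True k i * Y j) + (Y j * E False k i - E False k i * Y j))"
    by (simp add: sum_distrib_left sum_distrib_right distrib_left distrib_right sum.distrib sum_subtractf)
  also have "\<dots> = - (\<Sum>k\<in>UNIV - {i}. Sc (rt_coeff True k i j) * P True k i + Sc (rt_coeff False k i j) * P False k i)"
    unfolding sum_negf[symmetric] by (rule sum.cong) (simp_all add: YE)
  finally show ?thesis by (simp add: YF)
qed

lemma YD_ne:
  assumes "j \<noteq> i"
  shows "Y j * D i - D i * Y j = Sc u * (P True j i - P False j i)"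
proof -
  \<comment> \<open>As j differs from i, the weights vanish unless k = j, where they are -1 for the
    plain swap and 1 for the signed one.\<close>
  have "(\<Sum>k\<in>UNIV - {i}. Sc (rt_coeff True k i j) * P True k i + Sc (rt_coeff False k i j) * P False k i) =
      (\<Sum>k\<in>UNIV - {i}. if k = j then P False j i - P True j i else 0)"
    using assms by (intro sum.cong) (auto simp: rt_coeff_def Sc.hom_uminus)
  then show ?thesis
    using assms by (simp add: YD right_diff_distrib)
qed

lemma YD_eq: "Y i * D i - D i * Y i =
  - (Sc u * (\<Sum>k\<in>UNIV - {i}. P True k i + P False k i)) - Sc (complex_of_real (sqrt 2) * v) * G (neg_at i)"
  by (simp add: YD rt_coeff_def)

section \<open>Compatibility of the Dunkl operators with K\<close>

lemma kop_ke: "kop (ke b k i) =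
    (if b then 1 + kop (kc k) * kop (kc i) else 1 - kop (kc k) * kop (kc i)) * kop (kg (sw b k i))"
  by (simp add: ke_def kop.hom_simps)

lemma ke_clifford:
  assumes "k \<noteq> i"
  shows "kop (ke b k i) * kop (kc j) =
    (if j = i then - (kop (kc j) * kop (ke b k i)) else kop (kc j) * kop (ke b k i))"
proof -
  let ?a = "kop (kc k)" and ?b = "kop (kc i)" and ?c = "kop (kc j)"
  have gc: "kop (kg (swp k i)) * ?b = ?a * kop (kg (swp k i))"
    "kop (kg (swp k i)) * ?a = ?b * kop (kg (swp k i))"
    "kop (kg (swp_neg k i)) * ?b = - (?a * kop (kg (swp_neg k i)))"
    "kop (kg (swp_neg k i)) * ?a = - (?b * kop (kg (swp_neg k i)))"
    using kop_gc[of _ i] kop_gc[of _ k] by simp_all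
  note sw = swap_clifford[OF kop_rels(1) kop_rels(1) kop_rels(2)[OF assms] gc]
  consider "j = i" | "j = k" | "j \<noteq> i" "j \<noteq> k" by blast
  then show ?thesis
  proof cases
    case 3
    have "kop (kg (sw b k i)) * ?c = ?c * kop (kg (sw b k i))"
      using kop_gc[of "sw b k i" j] 3 by (simp add: sw_sel)
    note other = other_clifford[OF kop_rels(2)[OF 3(2)[symmetric]] kop_rels(2)[OF 3(1)[symmetric]] this]
    then show ?thesis using 3 by (cases b) (simp_all add: kop_ke)
  qed (use assms sw in \<open>cases b; simp add: kop_ke sw_def\<close>)+
qed

lemma EC:
  assumes "k \<noteq> i"
  shows "E b k i * C j = (if j = i then - (C j * E b k i) else C j * E b k i)"
proof -
  have "app (kop (ke b k i)) (app (kop (kc j)) m) =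
      app (if j = i then - (kop (kc j) * kop (ke b k i)) else kop (kc j) * kop (ke b k i)) m" for m
    by (simp flip: ke_clifford[OF assms])
  then show ?thesis
    using assms by (intro N_eqI) (auto simp: E_def C_def oper_tm ylin_intros tm_uminus)
qed

lemma FC: "F i * C j = (if j = i then - (C j * F i) else C j * F i)"
proof -
  have "app (kop (kg (neg_at i))) (app (kop (kc j)) m) =
      app ((if j = i then - kop (kc j) else kop (kc j)) * kop (kg (neg_at i))) m" for m
    using kop_gc[of "neg_at i" j] by (simp flip: app_simps(6))
  then show ?thesis
    by (intro N_eqI) (auto simp: F_def C_def oper_tm ylin_intros tm_uminus)
qed

text \<open>The flag \<open>s\<close> treats commuting and anticommuting at once: Clifford
  generators need both cases, scalars only the first.\<close>

lemma D_commute_sign: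
  assumes E: "\<And>b k. k \<noteq> i \<Longrightarrow> E b k i * z = (if s then z * E b k i else - (z * E b k i))"
    and F: "F i * z = (if s then z * F i else - (z * F i))" and Sc: "\<And>a. Sc a * z = z * Sc a"
  shows "D i * z = (if s then z * D i else - (z * D i))"
proof -
  have scale: "Sc a * y * z = (if s then z * (Sc a * y) else - (z * (Sc a * y)))"
    if "y * z = (if s then z * y else - (z * y))" for a y
    using that by (simp add: mult.assoc) (simp add: Sc flip: mult.assoc)
  have "(\<Sum>k\<in>UNIV - {i}. E True k i + E False k i) * z =
      (if s then z * (\<Sum>k\<in>UNIV - {i}. E True k i + E False k i)
       else - (z * (\<Sum>k\<in>UNIV - {i}. E True k i + E False k i)))"
    by (auto simp: sum_distrib_left sum_distrib_right distrib_left distrib_right E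
        simp flip: sum_negf intro!: sum.cong)
  from scale[OF this, of u] scale[OF F, of "complex_of_real (sqrt 2) * v"]
  show ?thesis by (cases s) (simp_all add: D_def distrib_left distrib_right)
qed

lemma DC: "D i * C j = (if j = i then - (C j * D i) else C j * D i)"
  using D_commute_sign[of i "C j" "j \<noteq> i"] by (auto simp: EC FC Sc_C)

lemma DSc: "D i * Sc a = Sc a * D i"
  using D_commute_sign[of i "Sc a" True] by (simp add: Sc_E Sc_F mult.commute flip: Sc.hom_mult)

lemma intertwine_mult:
  fixes g :: "'r::semigroup_mult"
  assumes "g * a = a' * g" "g * s = s' * g"
  shows "g * (a * s) = a' * s' * g"
proof -
  have "g * (a * s) = a' * (g * s)" using assms(1) by (simp flip: mult.assoc)
  then show ?thesis by (simp add: assms(2) mult.assoc)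
qed

text \<open>Moving w past c_k c_i produces the product of its signs at k and i. It is -1 exactly
  when the two kinds of swaps are exchanged, so a single flag describes the change of both factors
  of \<open>ke\<close>.\<close>

lemma ke_conj:
  "kop (kg w) * kop (ke b k i) =
   kop (ke (b = (sgn_at w k = sgn_at w i)) (prm w k) (prm w i)) * kop (kg w)"
proof -
  let ?g = "kop (kg w)" and ?b = "b = (sgn_at w k = sgn_at w i)"
  have "?g * (kop (kc k) * kop (kc i)) =
      (if sgn_at w k = sgn_at w i then 1 else - 1) * (kop (kc (prm w k)) * kop (kc (prm w i)) * ?g)"
  proof -
    have "?g * (kop (kc k) * z) =
        (if sgn_at w k = 1 then kop (kc (prm w k)) * (?g * z) else - (kop (kc (prm w k)) * (?g * z)))" for z
      by (simp add: kop_gc flip: mult.assoc)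
    then show ?thesis
      using sperm_props(2)[of w k] sperm_props(2)[of w i] by (auto simp: kop_gc mult.assoc)
  qed
  then have "?g * (if b then 1 + kop (kc k) * kop (kc i) else 1 - kop (kc k) * kop (kc i)) =
      (if ?b then 1 + kop (kc (prm w k)) * kop (kc (prm w i)) else 1 - kop (kc (prm w k)) * kop (kc (prm w i))) * ?g"
    by (auto simp: distrib_left distrib_right left_diff_distrib right_diff_distrib)
  moreover have "?g * kop (kg (sw b k i)) = kop (kg (sw ?b (prm w k) (prm w i))) * ?g"
    by (simp add: kop_rels sw_conj)
  ultimately show ?thesis
    unfolding kop_ke by (rule intertwine_mult)
qed

text \<open>The Clifford part is carried along without a sign; the sign at i comes only from the
  divided difference, because the roots are normalised at i.\<close>

lemma GE:
  assumes "k \<noteq> i"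
  shows "G w * E b k i =
    (if sgn_at w i = 1 then E (b = (sgn_at w k = sgn_at w i)) (prm w k) (prm w i)
     else - E (b = (sgn_at w k = sgn_at w i)) (prm w k) (prm w i)) * G w"
proof -
  let ?b = "b = (sgn_at w k = sgn_at w i)"
  have "app (kop (kg w)) (app (kop (ke b k i)) m) = app (kop (ke ?b (prm w k) (prm w i))) (app (kop (kg w)) m)" for m
    using ke_conj[of w b k i] by (metis app_simps(6))
  moreover have "yact w (dd (sw b k i) (rt b k i) f) =
      of_int (sgn_at w i) * dd (sw ?b (prm w k) (prm w i)) (rt ?b (prm w k) (prm w i)) (yact w f)" for f
    using dd_conj[OF root_sw[OF assms] root_sw sw_conj rt_conj sperm_props(2), where s = w and f = "yact w f"] assms
    by simp
  ultimately show ?thesis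
    using assms sperm_props(2)[of w i]
    by (intro N_eqI) (auto simp: E_def G_def oper_tm ylin_intros tm_uminus)
qed

lemma GF: "G w * F i = (if sgn_at w i = 1 then F (prm w i) else - F (prm w i)) * G w"
proof -
  have "app (kop (kg w)) (app (kop (kg (neg_at i))) m) = app (kop (kg (neg_at (prm w i)))) (app (kop (kg w)) m)" for m
    by (simp add: kop_rels neg_at_conj flip: app_simps(6))
  moreover have "yact w (dd (neg_at i) (2 * yvar i) f) =
      of_int (sgn_at w i) * dd (neg_at (prm w i)) (2 * yvar (prm w i)) (yact w f)" for f
  proof -
    have "yact w (2 * yvar i) = of_int (sgn_at w i) * (2 * yvar (prm w i))"
      by (simp only: mult_2 yact.hom_add yact_var distrib_left)
    from dd_conj[OF root_neg_at root_neg_at neg_at_conj this sperm_props(2), where f = "yact w f"]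
    show ?thesis by (simp only: yact_sinv)
  qed
  ultimately show ?thesis
    using sperm_props(2)[of w i]
    by (intro N_eqI) (auto simp: F_def G_def oper_tm ylin_intros tm_uminus)
qed

lemma GD: "G w * D i = (if sgn_at w i = 1 then D (prm w i) else - D (prm w i)) * G w"
proof -
  let ?S = "\<lambda>i. \<Sum>k\<in>UNIV - {i}. E True k i + E False k i"
  have "G w * ?S i = (\<Sum>k\<in>UNIV - {i}. (if sgn_at w i = 1 then E True (prm w k) (prm w i) + E False (prm w k) (prm w i)
      else - (E True (prm w k) (prm w i) + E False (prm w k) (prm w i))) * G w)"
    unfolding sum_distrib_left distrib_left
  proof (rule sum.cong[OF refl])
    fix k assume "k \<in> UNIV - {i}"
    \<comment> \<open>If the signs at k and i differ, the plain and the signed term trade places,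
      which leaves their sum unchanged. This is why the two families are summed together in
      \<open>D\<close>.\<close>
    then show "G w * E True k i + G w * E False k i =
        (if sgn_at w i = 1 then E True (prm w k) (prm w i) + E False (prm w k) (prm w i)
         else - (E True (prm w k) (prm w i) + E False (prm w k) (prm w i))) * G w"
      by (cases "sgn_at w k = sgn_at w i") (auto simp: GE distrib_right left_diff_distrib)
  qed
  also have "\<dots> = (if sgn_at w i = 1 then ?S (prm w i) else - ?S (prm w i)) * G w"
  proof -
    \<comment> \<open>The permutation underlying w carries the summation range for i to the one for
      its image, so the sum can be reindexed.\<close>
    have "bij_betw (prm w) (UNIV - {i}) (UNIV - {prm w i})"
      using bij_betw_DiffI[of "prm w" UNIV UNIV "{i}" "{prm w i}"] sperm_props(1)[of w] by auto
    from sum.reindex_bij_betw[OF this, of "\<lambda>k. E True k (prm w i) + E False k (prm w i)"]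
    have "?S (prm w i) = (\<Sum>k\<in>UNIV - {i}. E True (prm w k) (prm w i) + E False (prm w k) (prm w i))"
      by (rule sym)
    moreover have "(\<Sum>k\<in>A. (if s then f k else - f k) * z) = (if s then sum f A else - sum f A) * z"
      for s z A and f :: "'n \<Rightarrow> (('n \<Rightarrow>\<^sub>0 nat) \<Rightarrow>\<^sub>0 'm) endo"
      by (simp add: sum_negf flip: sum_distrib_right)
    ultimately show ?thesis by (simp only:)
  qed
  finally have S: "G w * ?S i = (if sgn_at w i = 1 then ?S (prm w i) else - ?S (prm w i)) * G w" .
  have G_Sc: "G w * (Sc a * z) = Sc a * (G w * z)" for a z
    by (simp add: Sc_G flip: mult.assoc)
  show ?thesis
    unfolding D_def distrib_left G_Sc S GF
    by (simp add: distrib_right mult.assoc left_diff_distrib)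
qed

section \<open>Commutativity of the Dunkl operators\<close>

lemma D_tm_one: "app (D i) (tm 1 m) = 0"
proof -
  have "app (E b k i) (tm 1 m) = 0" if "k \<noteq> i" for b k
    using that by (simp add: E_def oper_tm ylin_intros root.dd_one[OF root_sw])
  moreover have "app (F i) (tm 1 m) = 0"
    by (simp add: F_def oper_tm ylin_intros root.dd_one[OF root_neg_at])
  ultimately show ?thesis by (simp add: D_def app_sum_endo)
qed

text \<open>Applied to commutators of Dunkl operators, this reduces their vanishing to identities
  without divided differences.\<close>

lemma eq_zeroI:
  assumes Y: "\<And>j. Y j * Z = Z * Y j" and one: "\<And>m. app Z (tm 1 m) = 0"
  shows "Z = 0"
proof (rule N_eqI)
  fix f m
  have "app Z (tm f m) = 0"
  proof (induction f rule: ypoly_induct)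
    case (const a)
    show ?case using tm_scale[of a 1 m] one by simp
  next
    case (var j f)
    have "app Z (tm (yvar j * f) m) = app (Z * Y j) (tm f m)"
      by (simp add: Y_def oper_tm ylin_intros)
    then show ?case by (simp add: var flip: Y)
  qed (simp add: tm_add_left)
  then show "app Z (tm f m) = app 0 (tm f m)" by simp
qed

text \<open>With i outside {k, j}, the swap fixes the index of \<open>D i\<close>, and
  \<open>C k\<close> and \<open>C j\<close> both commute with it.\<close>

lemma P_D_commute:
  assumes "i \<noteq> k" "i \<noteq> j"
  shows "P b k j * D i = D i * P b k j"
proof -
  have "G (sw b k j) * D i = D i * G (sw b k j)"
    using GD[of "sw b k j" i] assms by (simp add: sw_sel)
  moreover have "C k * C j * G (sw b k j) * D i = D i * (C k * C j * G (sw b k j))"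
  proof -
    have "C k * C j * G (sw b k j) * D i = C k * (C j * D i) * G (sw b k j)"
      using calculation by (simp add: mult.assoc)
    also have "\<dots> = C k * D i * C j * G (sw b k j)"
      using DC[of i j] assms by (simp add: mult.assoc)
    also have "\<dots> = D i * (C k * C j * G (sw b k j))"
      using DC[of i k] assms by (simp flip: mult.assoc)
    finally show ?thesis .
  qed
  ultimately show ?thesis
    by (cases b) (simp_all add: P_def distrib_left distrib_right left_diff_distrib right_diff_distrib)
qed

text \<open>Up to the factors u and -u, the bracketed operators on the left are [Y_i, D_j] and those
  on the right the summand k = j of [Y_i, D_i]. A swap does not depend on the order of its indices,
  so both sides involve the same two group elements and \<open>dunkl_pair\<close> applies.\<close>

lemma D_pair:
  assumes "i \<noteq> j"
  shows "D i * (P True i j - P False i j) - (P True i j - P False i j) * D i =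
    (P True j i + P False j i) * D j - D j * (P True j i + P False j i)"
proof -
  have eq: "sw b j i = sw b i j" for b
    by (simp add: sw_def swp_commute[of j i])
  have "D i * C i = - (C i * D i)" "D i * C j = C j * D i" "D j * C j = - (C j * D j)" "D j * C i = C i * D j"
    using assms by (simp_all add: DC)
  moreover have "G (sw True i j) * D i = D j * G (sw True i j)" "G (sw True i j) * D j = D i * G (sw True i j)"
    "G (sw False i j) * D i = - (D j * G (sw False i j))" "G (sw False i j) * D j = - (D i * G (sw False i j))"
    using assms by (simp_all add: GD sw_sel)
  ultimately show ?thesis
    unfolding P_def if_True if_False simp_thms eq by (intro dunkl_pair CC(2) assms)
qed

lemma D_D: "D i * D j = D j * D i"
proof (cases "i = j")
  case False
  define A where "A k i = Y k * D i - D i * Y k" for k i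
  have A: "Y k * D i = D i * Y k + A k i" for k i
    by (simp add: A_def)
  have scale: "Sc a * z * D i = Sc a * (z * D i)" "D i * (Sc a * z) = Sc a * (D i * z)" for a z i
    by (simp_all add: mult.assoc) (simp add: DSc flip: mult.assoc)
  \<comment> \<open>By the Jacobi identity this equation says that Y_k commutes with [D_i, D_j]. It
    is symmetric in i and j, so k = j reduces to k = i.\<close>
  have eq: "D i * A k j - A k j * D i = D j * A k i - A k i * D j" for k
  proof -
    have same: "D i * A i j - A i j * D i = D j * A i i - A i i * D j" if "i \<noteq> j" for i j
    proof -
      let ?p = "P True i j - P False i j" and ?q = "P True j i + P False j i"
      \<comment> \<open>The summands of [Y_i, D_i] that avoid the index j. Like the sign change at
        i, they commute with D_j, so only the summand for j contributes.\<close>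
      define R where "R = (\<Sum>k\<in>UNIV - {i} - {j}. P True k i + P False k i)"
      have R: "R * D j = D j * R"
        unfolding R_def sum_distrib_left sum_distrib_right distrib_left distrib_right
        using that by (intro sum.cong) (auto simp: P_D_commute)
      have G: "G (neg_at i) * D j = D j * G (neg_at i)"
        using GD[of "neg_at i" j] that by simp
      have sum: "(\<Sum>k\<in>UNIV - {i}. P True k i + P False k i) = ?q + R"
        using that unfolding R_def by (subst sum.remove[of _ j]) auto
      have "D j * A i i - A i i * D j = Sc u * (?q * D j - D j * ?q)"
        unfolding A_def YD_eq sum
        by (simp add: right_diff_distrib left_diff_distrib distrib_left distrib_right scale R G)
      also have "\<dots> = Sc u * (D i * ?p - ?p * D i)"
        by (simp only: D_pair[OF that])
      also have "\<dots> = D i * A i j - A i j * D i"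
        unfolding A_def YD_ne[OF that] by (simp add: right_diff_distrib left_diff_distrib scale)
      finally show ?thesis ..
    qed
    \<comment> \<open>For a third index k the commutator A k j involves only k and j, hence commutes
      with D_i, and both sides of the desired equation vanish.\<close>
    have zero: "D i * A k j = A k j * D i" if "k \<noteq> i" "k \<noteq> j" "i \<noteq> j" for i j
      unfolding A_def YD_ne[OF that(2)]
      using that by (simp add: right_diff_distrib left_diff_distrib scale P_D_commute)
    consider "k = i" | "k = j" | "k \<noteq> i" "k \<noteq> j" by blast
    then show ?thesis
      by cases (use same[of i j] same[of j i] zero[of i j] zero[of j i] False in auto)
  qed
  have "D i * D j - D j * D i = 0"
  proof (rule eq_zeroI)
    fix k
    have "Y k * (D i * D j) = D i * D j * Y k + D i * A k j + A k i * D j" for i j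
      using A[of k i] A[of k j] by (simp add: distrib_left distrib_right mult.assoc flip: mult.assoc[of "Y k"])
    from this[of i j] this[of j i] eq[of k]
    show "Y k * (D i * D j - D j * D i) = (D i * D j - D j * D i) * Y k"
      by (simp add: right_diff_distrib left_diff_distrib algebra_simps)
  qed (simp add: D_tm_one)
  then show ?thesis by simp
qed simp

end


text \<open>Turns an additive type into a group record, as the universal property of the tensor
  product requires of its target.\<close>

definition add_grp :: "'a::ab_group_add monoid" where
  "add_grp = \<lparr>carrier = UNIV, monoid.mult = (+), one = 0\<rparr>"

lemma add_grp_simps [simp]:
  "carrier add_grp = UNIV" "x \<otimes>\<^bsub>add_grp\<^esub> y = x + y" "\<one>\<^bsub>add_grp\<^esub> = 0"
  by (simp_all add: add_grp_def)

lemma comm_group_add_grp: "comm_group (add_grp :: 'a::ab_group_add monoid)"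
proof (rule comm_groupI)
  fix x :: 'a
  show "\<exists>y\<in>carrier add_grp. y \<otimes>\<^bsub>add_grp\<^esub> x = \<one>\<^bsub>add_grp\<^esub>"
    by (auto intro: exI[of _ "- x"])
qed (auto simp: algebra_simps)

section \<open>Polynomials in the y_i inside the algebra\<close>

lemma hcls_simps:
  "hcls u v a \<otimes>\<^bsub>H_alg u v\<^esub> hcls u v b = hcls u v (a * b)"
  "hcls u v a \<oplus>\<^bsub>H_alg u v\<^esub> hcls u v b = hcls u v (a + b)"
  "\<ominus>\<^bsub>H_alg u v\<^esub> hcls u v a = hcls u v (- a)"
  "\<one>\<^bsub>H_alg u v\<^esub> = hcls u v 1"
  by (simp_all add: H_alg_def hcls_def cls_mult cls_add cls_uminus cls_one)

lemma hcls_closed: "hcls u v a \<in> carrier (H_alg u v)"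
  by (simp add: H_alg_def hcls_def)

lemma carrier_H: "carrier (H_alg u v) = range (hcls u v)"
  by (simp add: H_alg_def carrier_presented hcls_def[abs_def])

lemma ring_H: "ring (H_alg u v)"
  unfolding H_alg_def by (rule ring_presented)

lemma hcls_rel: "a - b \<in> H_rels u v \<Longrightarrow> hcls u v a = hcls u v b"
  unfolding hcls_def by (rule cls_relI)

text \<open>Relations hold only between classes and cannot be rewritten under \<open>hcls\<close>;
  these congruence rules replace one factor or summand of a representative at a time.\<close>

lemma hcls_mult: "hcls u v a = hcls u v a' \<Longrightarrow> hcls u v b = hcls u v b' \<Longrightarrow> hcls u v (a * b) = hcls u v (a' * b')"
  and hcls_add: "hcls u v a = hcls u v a' \<Longrightarrow> hcls u v b = hcls u v b' \<Longrightarrow> hcls u v (a + b) = hcls u v (a' + b')"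
  by (simp_all flip: hcls_simps)

definition ymon :: "('n::{finite, linorder} \<Rightarrow>\<^sub>0 nat) \<Rightarrow> 'n hgen free_alg" where
  "ymon \<alpha> = prod_list (map (\<lambda>i. hy i ^ Poly_Mapping.lookup \<alpha> i) (sorted_list_of_set UNIV))"

text \<open>A representative of \<open>yeval\<close> in the free algebra. The y_i do not commute at
  this level, so additivity and scaling are exact, but multiplication by a variable is compatible
  only after applying \<open>hcls\<close>.\<close>

definition yev :: "'n::{finite, linorder} ypoly \<Rightarrow> 'n hgen free_alg" where
  "yev = psum (\<lambda>\<alpha> a. scal a * ymon \<alpha>)"

lemma yeval_eq: "yeval u v f = hcls u v (yev f)"
  by (simp add: yeval_def yev_def psum_def ymon_def)

lemma yev_add: "yev (f + g) = yev f + yev g"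
  unfolding yev_def by (rule psum_add) (simp add: scal_simps distrib_right)

lemma yev_single: "yev (Poly_Mapping.single \<alpha> a) = scal a * ymon \<alpha>"
  unfolding yev_def by (rule psum_single) (simp add: scal_def)

lemma yev_scale: "yev (yconst a * f) = scal a * yev f"
  by (induction f rule: poly_mapping_add_induct)
    (simp_all add: distrib_left yev_add yconst_def mult_single yev_single scal_simps mult.assoc)

lemma yev_one: "yev (1 :: 'n::{finite, linorder} ypoly) = 1"
proof -
  have "prod_list (map (\<lambda>i. 1) xs) = (1 :: 'n hgen free_alg)" for xs :: "'n list"
    by (induction xs) simp_all
  then have "ymon 0 = (1 :: 'n hgen free_alg)" by (simp add: ymon_def)
  then show ?thesis using yev_single[of "0 :: 'n \<Rightarrow>\<^sub>0 nat" 1] by (simp add: scal_simps)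
qed

lemma yev_const: "yev (yconst a) = scal a"
  using yev_scale[of a 1] by (simp add: yev_one)

lemma hcls_YY: "hcls u v (hy i * hy j) = hcls u v (hy j * hy i)"
  by (rule hcls_rel) (auto simp: H_rels_def)

lemma hcls_Y_power: "hcls u v (hy j * hy i ^ k) = hcls u v (hy i ^ k * hy j)"
proof (induction k)
  case (Suc k)
  have "hcls u v (hy j * hy i ^ Suc k) = hcls u v (hy i * hy j * hy i ^ k)"
    using hcls_mult[OF hcls_YY[of u v j i] refl, of "hy i ^ k"] by (simp add: mult.assoc)
  also have "\<dots> = hcls u v (hy i * (hy i ^ k * hy j))"
    unfolding mult.assoc by (rule hcls_mult[OF refl Suc.IH])
  finally show ?case by (simp add: mult.assoc)
qed simp

text \<open>The factor y_j travels to its own slot in the ordered product and raises the exponent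
  there; distinctness ensures that no later slot belongs to j.\<close>

lemma hcls_Y_prod:
  "distinct xs \<Longrightarrow> j \<in> set xs \<Longrightarrow>
    hcls u v (hy j * prod_list (map (\<lambda>i. hy i ^ Poly_Mapping.lookup \<alpha> i) xs)) =
    hcls u v (prod_list (map (\<lambda>i. hy i ^ Poly_Mapping.lookup (Poly_Mapping.single j 1 + \<alpha>) i) xs))"
proof (induction xs)
  case (Cons i xs)
  let ?\<beta> = "Poly_Mapping.single j 1 + \<alpha>"
  show ?case
  proof (cases "i = j")
    case True
    then have "map (\<lambda>i. hy i ^ Poly_Mapping.lookup \<alpha> i) xs = map (\<lambda>i. hy i ^ Poly_Mapping.lookup ?\<beta> i) xs"
      using Cons.prems by (auto simp: lookup_add lookup_single when_def)
    moreover have "Poly_Mapping.lookup ?\<beta> j = Suc (Poly_Mapping.lookup \<alpha> j)"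
      by (simp add: lookup_add)
    ultimately show ?thesis
      by (simp only: list.map prod_list.Cons True power_Suc mult.assoc)
  next
    case False
    let ?k = "Poly_Mapping.lookup \<alpha> i" and ?p = "\<lambda>\<alpha>. prod_list (map (\<lambda>i. hy i ^ Poly_Mapping.lookup \<alpha> i) xs)"
    have "hcls u v (hy j * (hy i ^ ?k * ?p \<alpha>)) = hcls u v (hy i ^ ?k * (hy j * ?p \<alpha>))"
      using hcls_mult[OF hcls_Y_power[of u v j i ?k] refl, of "?p \<alpha>"] by (simp add: mult.assoc)
    also have "\<dots> = hcls u v (hy i ^ ?k * ?p ?\<beta>)"
      using Cons False by (intro hcls_mult[OF refl]) auto
    finally show ?thesis
      using False by (simp add: lookup_add lookup_single_not_eq)
  qed
qed simp

lemma hcls_yev_var: "hcls u v (yev (yvar j * f)) = hcls u v (hy j * yev f)"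
proof (induction f rule: poly_mapping_add_induct)
  case (single \<alpha> a)
  have "hcls u v (scal a * (hy j * ymon \<alpha>)) = hcls u v (scal a * ymon (Poly_Mapping.single j 1 + \<alpha>))"
    unfolding ymon_def by (rule hcls_mult[OF refl hcls_Y_prod]) simp_all
  then show ?case
    by (simp add: yvar_def mult_single yev_single scal_commute[of a "hy j"] flip: mult.assoc)
next
  case (add f g)
  then show ?case by (simp add: distrib_left yev_add flip: hcls_simps)
qed

lemma hcls_YC: "hcls u v (hc j * hy k) = hcls u v (hy k * hc j)"
  by (rule hcls_rel[symmetric]) (auto simp: H_rels_def)

lemma hcls_C_yev: "hcls u v (hc j * yev f) = hcls u v (yev f * hc j)"
proof (induction f rule: ypoly_induct)
  case (const a)
  show ?case by (simp add: yev_const scal_commute)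
next
  case (var k f)
  have "hcls u v (hc j * yev (yvar k * f)) = hcls u v (hc j * (hy k * yev f))"
    by (intro hcls_mult refl hcls_yev_var)
  also have "\<dots> = hcls u v (hy k * hc j * yev f)"
    unfolding mult.assoc[symmetric] by (intro hcls_mult refl hcls_YC)
  also have "\<dots> = hcls u v (hy k * (yev f * hc j))"
    unfolding mult.assoc by (intro hcls_mult refl var)
  also have "\<dots> = hcls u v (yev (yvar k * f) * hc j)"
    unfolding mult.assoc[symmetric] by (intro hcls_mult refl hcls_yev_var[symmetric])
  finally show ?case .
next
  case (add f g)
  then show ?case by (simp add: distrib_left distrib_right yev_add flip: hcls_simps(2))
qed

lemma hcls_GY: "hcls u v (hg w * hy k) = hcls u v (of_int (sgn_at w k) * hy (prm w k) * hg w)"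
proof -
  have "hcls u v (hg (sinv w) * hg w) = hcls u v (hg (sinv w * w))"
    by (rule hcls_rel) (auto simp: H_rels_def K_rels_def)
  also have "\<dots> = hcls u v 1"
    unfolding sinv_left by (rule hcls_rel) (auto simp: H_rels_def K_rels_def)
  finally have "hcls u v (hg w * hy k * (hg (sinv w) * hg w)) = hcls u v (hg w * hy k * 1)"
    by (intro hcls_mult refl)
  moreover have "hcls u v (hg w * hy k * hg (sinv w) * hg w) = hcls u v (of_int (sgn_at w k) * hy (prm w k) * hg w)"
    by (intro hcls_mult refl hcls_rel) (auto simp: H_rels_def)
  ultimately show ?thesis by (simp add: mult.assoc)
qed

lemma yev_of_int: "yev (of_int e * f) = of_int e * yev (f :: 'n::{finite, linorder} ypoly)"
proof -
  have "(of_int e :: 'n hgen free_alg) = scal (of_int e)" by (simp add: scal_def)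
  then show ?thesis by (simp add: of_int_ypoly yev_scale)
qed

text \<open>Together with \<open>hcls_C_yev\<close> this moves elements of K to the right of a
  polynomial, where the tensor sign lets M absorb them.\<close>

lemma hcls_G_yev: "hcls u v (hg w * yev f) = hcls u v (yev (yact w f) * hg w)"
proof (induction f rule: ypoly_induct)
  case (const a)
  show ?case by (simp add: yev_const scal_commute)
next
  case (var k f)
  let ?e = "of_int (sgn_at w k) :: 'n hgen free_alg"
  have "hcls u v (hg w * yev (yvar k * f)) = hcls u v (hg w * (hy k * yev f))"
    by (intro hcls_mult refl hcls_yev_var)
  also have "\<dots> = hcls u v (?e * hy (prm w k) * hg w * yev f)"
    unfolding mult.assoc[symmetric] by (intro hcls_mult refl hcls_GY)
  also have "\<dots> = hcls u v (?e * hy (prm w k) * (yev (yact w f) * hg w))"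
    unfolding mult.assoc by (intro hcls_mult[OF refl] var)
  also have "\<dots> = hcls u v (?e * yev (yvar (prm w k) * yact w f) * hg w)"
    using hcls_mult[OF hcls_mult[OF refl hcls_yev_var[symmetric]] refl, of u v ?e "prm w k" "yact w f" "hg w"]
    by (simp only: mult.assoc)
  also have "\<dots> = hcls u v (yev (yact w (yvar k * f)) * hg w)"
    by (simp only: yact.hom_mult yact_var mult.assoc yev_of_int)
  finally show ?case .
next
  case (add f g)
  then show ?case by (simp add: distrib_left distrib_right yev_add yact.hom_add flip: hcls_simps(2))
qed

section \<open>The representation on the model and the extension of M by zero\<close>

context K_module
begin

definition genop :: "'n hgen \<Rightarrow> (('n \<Rightarrow>\<^sub>0 nat) \<Rightarrow>\<^sub>0 'm) endo" where
  "genop g = (case g of Xgen i \<Rightarrow> D i | Ygen j \<Rightarrow> Y j | Kgen k \<Rightarrow> (case k of Clf i \<Rightarrow> C i | Grp w \<Rightarrow> G w))"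

sublocale H: free_hom_data Sc genop
  by unfold_locales
    (auto simp: genop_def Sc_Y Sc_C Sc_G DSc split: hgen.splits kgen.splits)

definition rep :: "'n hgen free_alg \<Rightarrow> (('n \<Rightarrow>\<^sub>0 nat) \<Rightarrow>\<^sub>0 'm) endo" where
  "rep = free_hom Sc genop"

sublocale rep: unital_hom rep
  unfolding rep_def by (rule H.free.unital_hom_axioms)

lemma rep_gen [simp]: "rep (hx i) = D i" "rep (hy j) = Y j" "rep (hc i) = C i" "rep (hg w) = G w"
  and rep_scal [simp]: "rep (scal a) = Sc a"
  unfolding rep_def by (simp_all add: H.free_hom_gen H.free_hom_scal genop_def)

lemma rep_conj:
  assumes "G w * z = (if sgn_at w i = 1 then z' else - z') * G w"
  shows "G w * z * G (sinv w) = (if sgn_at w i = 1 then z' else - z')"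
  using assms by (simp add: mult.assoc GG sinv_right G_one)

lemma rep_rels:
  assumes "r \<in> H_rels u v"
  shows "rep r = 0"
proof -
  note sign = hom_sign[OF rep.unital_hom_axioms sperm_props(2)]
  have K: "rep r = 0" if "r \<in> K_rels hc hg"
  proof -
    have "rep (hc i * hc i - 1) = 0" "rep (hg 1 - 1) = 0" "rep (hg w * hg w' - hg (w * w')) = 0" for i w w'
      by (simp_all add: rep.hom_simps CC(1) G_one GG)
    moreover have "rep (hc i * hc j + hc j * hc i) = 0" if "i \<noteq> j" for i j
      using CC(2)[OF that] by (simp add: rep.hom_simps)
    moreover have "rep (hg w * hc i * hg (sinv w) - of_int (sgn_at w i) * hc (prm w i)) = 0" for w i
      unfolding rep.hom_diff sign unfolding rep.hom_mult rep_gen rep_conj[OF GC] by simp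
    ultimately show ?thesis
      using that unfolding K_rels_def by (elim UnE CollectE exE conjE insertE emptyE) simp_all
  qed
  have X: "rep (hx i * hx j - hx j * hx i) = 0" "rep (hx i * hc i + hc i * hx i) = 0"
    "i \<noteq> j \<Longrightarrow> rep (hx i * hc j - hc j * hx i) = 0" for i j
    using D_D[of i j] by (simp_all add: rep.hom_simps DC)
  have Y: "rep (hy i * hy j - hy j * hy i) = 0" "rep (hy i * hc j - hc j * hy i) = 0" for i j
    using YY[of i j] by (simp_all add: rep.hom_simps YC)
  have G: "rep (hg w * hx i * hg (sinv w) - of_int (sgn_at w i) * hx (prm w i)) = 0"
    "rep (hg w * hy i * hg (sinv w) - of_int (sgn_at w i) * hy (prm w i)) = 0" for w i
    unfolding rep.hom_diff sign unfolding rep.hom_mult rep_gen rep_conj[OF GD] rep_conj[OF GY] by simp_all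
  have ne: "rep ((hy j * hx i - hx i * hy j)
      - scal u * ((1 + hc j * hc i) * hg (swp i j) - (1 - hc j * hc i) * hg (swp_neg i j))) = 0"
    if "i \<noteq> j" for i j
    using YD_ne[OF that[symmetric]] by (simp add: rep.hom_simps P_def sw_def swp_commute[of i j])
  have eq: "rep ((hy i * hx i - hx i * hy i) - (- scal u * (\<Sum>k\<in>UNIV - {i}.
      (1 + hc k * hc i) * hg (swp k i) + (1 - hc k * hc i) * hg (swp_neg k i))
      - scal (complex_of_real (sqrt 2) * v) * hg (neg_at i))) = 0" for i
    using YD_eq[of i] by (simp add: rep.hom_simps P_def sw_def)
  from assms show ?thesis
    unfolding H_rels_def by (elim UnE CollectE exE conjE) (simp_all only: K X Y G ne eq not_False_eq_True)
qed

text \<open>\<open>rep\<close> lives on the free algebra. It kills the relations, so the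
  representative picked here is immaterial, as \<open>hact_hcls\<close> confirms.\<close>

definition hact :: "'n hgen free_alg set \<Rightarrow> (('n \<Rightarrow>\<^sub>0 nat) \<Rightarrow>\<^sub>0 'm) endo" where
  "hact Z = rep (SOME a. Z = hcls u v a)"

lemma hact_hcls [simp]: "hact (hcls u v a) = rep a"
proof -
  have "hcls u v a = hcls u v (SOME b. hcls u v a = hcls u v b)" by (rule someI) (rule refl)
  from hom_Idl_factor[OF rep.unital_hom_axioms rep_rels this[unfolded hcls_def[abs_def]]]
  show ?thesis by (simp add: hact_def hcls_def[abs_def])
qed

lemma Hx_closed: "h \<in> Hx_set u v \<Longrightarrow> h \<in> carrier (H_alg u v)"
  unfolding Hx_set_def
  by (rule ring.generate_ring_in_carrier[OF ring_H]) (auto simp: carrier_H)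

lemma hact_simps:
  assumes "h \<in> carrier (H_alg u v)" "h' \<in> carrier (H_alg u v)"
  shows "hact (h \<oplus>\<^bsub>H_alg u v\<^esub> h') = hact h + hact h'" "hact (h \<otimes>\<^bsub>H_alg u v\<^esub> h') = hact h * hact h'"
  using assms by (auto simp: carrier_H hcls_simps rep.hom_simps)

lemma hact_uminus: "h \<in> carrier (H_alg u v) \<Longrightarrow> hact (\<ominus>\<^bsub>H_alg u v\<^esub> h) = - hact h"
  by (auto simp: carrier_H hcls_simps rep.hom_simps)

text \<open>The witness for the choice in \<open>Hx_act\<close>: the constant coefficient of h(1 (x)
  m). On \<open>Hx_set\<close> nothing is lost, because h(1 (x) m) stays in 1 (x) M.\<close>

definition rho :: "'n hgen free_alg set \<Rightarrow> 'm \<Rightarrow> 'm" where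
  "rho h m = Poly_Mapping.lookup (app (hact h) (tm 1 m)) 0"

lemma lookup_tm_one: "Poly_Mapping.lookup (tm 1 m) 0 = m"
  by (simp add: tm_one)

lemma Hx_gens:
  "hcls u v (scal a) \<in> Hx_set u v" "hcls u v (hc i) \<in> Hx_set u v" "hcls u v (hg w) \<in> Hx_set u v"
  "hcls u v (hx i) \<in> Hx_set u v"
  unfolding Hx_set_def by (rule generate_ring.incl; blast)+

lemma rep_tm_one:
  "app (Sc a) (tm 1 m) = tm 1 (act (kcls (scal a)) m)" "app (C i) (tm 1 m) = tm 1 (act (kcls (kc i)) m)"
  "app (G w) (tm 1 m) = tm 1 (act (kcls (kg w)) m)"
  by (simp_all add: Sc_def C_def G_def oper_tm ylin_intros app_kop)

text \<open>Stability of 1 (x) M passes from the generators to the generated ring, so the induction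
  only asserts that some m' exists; the constant coefficient then recovers it.\<close>

lemma hact_rho: "h \<in> Hx_set u v \<Longrightarrow> app (hact h) (tm 1 m) = tm 1 (rho h m)"
proof -
  assume "h \<in> Hx_set u v"
  then have "\<forall>m. \<exists>m'. app (hact h) (tm 1 m) = tm 1 m'"
    unfolding Hx_set_def
  proof (induction h rule: generate_ring.induct)
    case one
    then show ?case by (auto simp: hcls_simps)
  next
    case (incl h)
    then show ?case
      by (auto simp: rep_tm_one D_tm_one) (metis tm_zero(2))
  next
    case (a_inv h)
    then have h: "h \<in> carrier (H_alg u v)" by (intro Hx_closed) (simp add: Hx_set_def)
    show ?case
    proof
      fix m
      obtain m' where "app (hact h) (tm 1 m) = tm 1 m'" using a_inv by blast
      then have "app (hact (\<ominus>\<^bsub>H_alg u v\<^esub> h)) (tm 1 m) = tm 1 (- m')"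
        by (simp add: hact_uminus h tm_uminus)
      then show "\<exists>m'. app (hact (\<ominus>\<^bsub>H_alg u v\<^esub> h)) (tm 1 m) = tm 1 m'" ..
    qed
  next
    case (eng_add h1 h2)
    then have h: "h1 \<in> carrier (H_alg u v)" "h2 \<in> carrier (H_alg u v)"
      by (auto intro!: Hx_closed simp: Hx_set_def)
    show ?case
    proof
      fix m
      obtain m1 m2 where "app (hact h1) (tm 1 m) = tm 1 m1" "app (hact h2) (tm 1 m) = tm 1 m2"
        using eng_add by blast
      then have "app (hact (h1 \<oplus>\<^bsub>H_alg u v\<^esub> h2)) (tm 1 m) = tm 1 (m1 + m2)"
        by (simp add: hact_simps h tm_add_right)
      then show "\<exists>m'. app (hact (h1 \<oplus>\<^bsub>H_alg u v\<^esub> h2)) (tm 1 m) = tm 1 m'" ..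
    qed
  next
    case (eng_mult h1 h2)
    then have h: "h1 \<in> carrier (H_alg u v)" "h2 \<in> carrier (H_alg u v)"
      by (auto intro!: Hx_closed simp: Hx_set_def)
    show ?case
    proof
      fix m
      obtain m2 where "app (hact h2) (tm 1 m) = tm 1 m2" using eng_mult by blast
      moreover obtain m1 where "app (hact h1) (tm 1 m2) = tm 1 m1" using eng_mult by blast
      ultimately have "app (hact (h1 \<otimes>\<^bsub>H_alg u v\<^esub> h2)) (tm 1 m) = tm 1 m1"
        by (simp add: hact_simps h)
      then show "\<exists>m'. app (hact (h1 \<otimes>\<^bsub>H_alg u v\<^esub> h2)) (tm 1 m) = tm 1 m'" ..
    qed
  qed
  then show ?thesis
    unfolding rho_def by (metis lookup_tm_one)
qed

lemma tm_one_inject: "tm 1 m = tm 1 m' \<longleftrightarrow> m = m'"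
  by (metis lookup_tm_one)

abbreviation "Hx \<equiv> H_alg u v\<lparr>carrier := Hx_set u v\<rparr>"

lemma ring_Hx: "ring Hx"
  unfolding Hx_set_def
  by (rule ring.generate_ring_is_ring[OF ring_H]) (auto simp: carrier_H)

lemma left_module_rho: "left_module Hx rho"
proof -
  interpret ring Hx by (rule ring_Hx)
  show ?thesis
  proof (unfold_locales, goal_cases)
    case (1 a b m)
    then show ?case
      by (simp add: rho_def hact_simps Hx_closed lookup_add)
  next
    case (2 a m m')
    then show ?case by (simp add: rho_def tm_add_right lookup_add)
  next
    case (3 a b m)
    then have "a \<in> Hx_set u v" "b \<in> Hx_set u v" "a \<otimes>\<^bsub>H_alg u v\<^esub> b \<in> Hx_set u v"
      using m_closed[of a b] by simp_all
    then show ?case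
      using hact_rho[of "a \<otimes>\<^bsub>H_alg u v\<^esub> b" m] hact_rho[of a "rho b m"] hact_rho[of b m]
      by (simp add: hact_simps Hx_closed tm_one_inject)
  next
    case (4 m)
    then show ?case by (simp add: rho_def hcls_simps lookup_tm_one)
  qed
qed

abbreviation "\<rho> \<equiv> Hx_act u v act"

text \<open>The choice is legitimate because \<open>rho\<close> satisfies its conditions. From here
  on the chosen \<open>\<rho>\<close> is used only through these properties.\<close>

lemma rho_spec:
  "left_module Hx \<rho> \<and>
     (\<forall>a. \<rho> (hcls u v (scal a)) = act (kcls (scal a))) \<and>
     (\<forall>i. \<rho> (hcls u v (hc i)) = act (kcls (kc i))) \<and>
     (\<forall>w. \<rho> (hcls u v (hg w)) = act (kcls (kg w))) \<and>
     (\<forall>i m. \<rho> (hcls u v (hx i)) m = 0)"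
  unfolding Hx_act_def
proof (rule someI[of _ rho], intro conjI allI left_module_rho)
qed (simp_all add: rho_def rep_tm_one D_tm_one lookup_tm_one fun_eq_iff)

lemma rho_values:
  "\<rho> (hcls u v (scal a)) = act (kcls (scal a))" "\<rho> (hcls u v (hc i)) = act (kcls (kc i))"
  "\<rho> (hcls u v (hg w)) = act (kcls (kg w))" "\<rho> (hcls u v (hx i)) m = 0"
  using rho_spec by auto

sublocale Hx: left_module Hx \<rho>
  using rho_spec by blast

text \<open>A module structure on \<open>Hx_set\<close> is determined by its values on generators,
  so the chosen action agrees with the one read off from the model. This is the balancing condition
  for the map from M_x to the model.\<close>

lemma hact_Hx_act: "h \<in> Hx_set u v \<Longrightarrow> app (hact h) (tm 1 m) = tm 1 (\<rho> h m)"
proof -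
  assume "h \<in> Hx_set u v"
  then have "h \<in> generate_ring (H_alg u v) (hcls u v ` (range scal \<union> range hc \<union> range hg \<union> range hx))"
    by (simp add: Hx_set_def)
  then have "\<forall>m. app (hact h) (tm 1 m) = tm 1 (\<rho> h m)"
  proof (induction h rule: generate_ring.induct)
    case one
    then show ?case using Hx.act_one by (simp add: hcls_simps)
  next
    case (incl h)
    then show ?case by (auto simp: rep_tm_one D_tm_one rho_values)
  next
    case (a_inv h)
    then have h: "h \<in> Hx_set u v" "\<ominus>\<^bsub>H_alg u v\<^esub> h \<in> Hx_set u v"
      by (auto simp: Hx_set_def intro: generate_ring.a_inv)
    \<comment> \<open>The module axioms do not mention zero or negatives; that the zero class acts
      as 0 follows from 0 + 0 = 0, and then additive inverses act by negatives.\<close>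
    define zc where "zc = hcls u v (0 :: 'n hgen free_alg)"
    have z: "h \<oplus>\<^bsub>H_alg u v\<^esub> \<ominus>\<^bsub>H_alg u v\<^esub> h = zc" "zc \<oplus>\<^bsub>H_alg u v\<^esub> zc = zc"
      using Hx_closed[OF h(1)] by (auto simp: zc_def carrier_H hcls_simps)
    have "zc \<in> Hx_set u v"
      using Hx_gens(1)[of 0] by (simp add: scal_def zc_def)
    then have "\<rho> zc m = 0" for m
      using Hx.act_add_left[of zc zc m] z by simp
    then have "\<rho> (\<ominus>\<^bsub>H_alg u v\<^esub> h) m = - \<rho> h m" for m
      using Hx.act_add_left[of h "\<ominus>\<^bsub>H_alg u v\<^esub> h" m] z h
      by (simp add: eq_neg_iff_add_eq_0 add.commute)
    then show ?case
      using a_inv hact_uminus[OF Hx_closed[OF h(1)]] by (simp add: tm_uminus)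
  next
    case (eng_add h1 h2)
    then have h: "h1 \<in> Hx_set u v" "h2 \<in> Hx_set u v" by (auto simp: Hx_set_def)
    then show ?case
      using eng_add Hx.act_add_left[of h1 h2] by (simp add: hact_simps Hx_closed tm_add_right)
  next
    case (eng_mult h1 h2)
    then have h: "h1 \<in> Hx_set u v" "h2 \<in> Hx_set u v" by (auto simp: Hx_set_def)
    then show ?case
      using eng_mult Hx.act_mult[of h1 h2] by (simp add: hact_simps Hx_closed)
  qed
  then show ?thesis by blast
qed


section \<open>The two tensor products and the maps between them\<close>

sublocale Mx: tensor_data "H_alg u v" "Hx_set u v" \<rho>
  by (intro tensor_data.intro ring_H tensor_data_axioms.intro Hx_closed)

sublocale PM: tensor_data "type_ring :: 'n ypoly ring" "range yconst" "const_act act"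
  by (intro tensor_data.intro ring_type_ring tensor_data_axioms.intro) simp

lemma PM_eq: "PM act = PM.T"
  by (simp add: PM_def)

lemma pt_eq: "pt act f m = PM.pure f m"
  by (simp add: pt_def)

lemma const_act_yconst: "const_act act (yconst a) = app (kop (scal a))"
  by (simp add: const_act_def yconst_def app_kop fun_eq_iff)

lemma pt_closed: "pt act f m \<in> carrier PM.T"
  by (simp add: pt_eq)

lemma pt_scale: "pt act (yconst a * f) m = pt act f (app (kop (scal a)) m)"
  using PM.pure_balanced[of f "yconst a" m] by (simp add: pt_eq const_act_yconst mult.commute)

lemma tensor_map_ident:
  "tensor_map_data type_ring (range yconst) (const_act act) (H_alg u v) (Hx_set u v) \<rho> (yeval u v)"
proof (intro tensor_map_data.intro tensor_map_data_axioms.intro Mx.tensor_data_axioms PM.tensor_data_axioms)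
  fix f s :: "'n ypoly" and m
  assume "s \<in> range yconst"
  then obtain a where s: "s = yconst a" by blast
  have "yeval u v (f * s) = hcls u v (yev f) \<otimes>\<^bsub>H_alg u v\<^esub> hcls u v (scal a)"
    by (simp add: s yeval_eq hcls_simps yev_scale scal_commute mult.commute[of f])
  then show "Mx.pure (yeval u v (f \<otimes>\<^bsub>type_ring\<^esub> s)) m = Mx.pure (yeval u v f) (const_act act s m)"
    by (simp add: Mx.pure_balanced hcls_closed Hx_gens rho_values s const_act_yconst app_kop yeval_eq)
qed (simp_all add: yeval_eq hcls_closed hcls_simps yev_add)

sublocale ident: tensor_map_data type_ring "range yconst" "const_act act" "H_alg u v" "Hx_set u v" \<rho> "yeval u v"
  by (rule tensor_map_ident)

lemma ident_pt: "ident u v act (pt act f m) = Mx.pure (hcls u v (yev f)) m"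
  using ident.tensor_map_pure[of f m] by (simp add: ident_def pt_eq yeval_eq)

lemma ident_hom: "ident u v act \<in> hom PM.T Mx.T"
  using ident.tensor_map_hom by (simp add: ident_def)

lemma psmult_data:
  "tensor_map_data (type_ring :: 'n ypoly ring) (range yconst) (const_act act) type_ring (range yconst) (const_act act) (\<lambda>f. yconst a * f)"
  by (intro tensor_map_data.intro tensor_map_data_axioms.intro PM.tensor_data_axioms)
    (use PM.pure_balanced[of "yconst a * _"] in \<open>auto simp: distrib_left mult.assoc\<close>)

lemma psmult_pt: "psmult act a (pt act f m) = pt act (yconst a * f) m"
  using tensor_map_data.tensor_map_pure[OF psmult_data] by (simp add: psmult_def pt_eq)

lemma psmult_hom: "psmult act a \<in> hom PM.T PM.T"
  using tensor_map_data.tensor_map_hom[OF psmult_data] by (simp add: psmult_def)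

lemma ind_act_data:
  assumes h: "h \<in> carrier (H_alg u v)"
  shows "tensor_map_data (H_alg u v) (Hx_set u v) \<rho> (H_alg u v) (Hx_set u v) \<rho> (\<lambda>b. h \<otimes>\<^bsub>H_alg u v\<^esub> b)"
proof -
  interpret ring "H_alg u v" by (rule ring_H)
  show ?thesis
    by (intro tensor_map_data.intro tensor_map_data_axioms.intro Mx.tensor_data_axioms)
      (auto simp: h r_distr Mx.pure_balanced Hx_closed simp flip: m_assoc)
qed

abbreviation "J a \<equiv> ind_act u v act (hcls u v a)"

lemma J_pure: "J a (Mx.pure (hcls u v b) m) = Mx.pure (hcls u v (a * b)) m"
  using tensor_map_data.tensor_map_pure[OF ind_act_data[OF hcls_closed] hcls_closed]
  by (simp add: ind_act_def hcls_simps)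

lemma J_hom: "J a \<in> hom Mx.T Mx.T"
  using tensor_map_data.tensor_map_hom[OF ind_act_data[OF hcls_closed]] by (simp add: ind_act_def)

lemma Mx_induct [consumes 1, case_names pure mult]:
  assumes "z \<in> carrier Mx.T"
    and "\<And>a m. Q (Mx.pure (hcls u v a) m)"
    and "\<And>x y. x \<in> carrier Mx.T \<Longrightarrow> y \<in> carrier Mx.T \<Longrightarrow> Q x \<Longrightarrow> Q y \<Longrightarrow> Q (x \<otimes>\<^bsub>Mx.T\<^esub> y)"
  shows "Q z"
  using assms by (induction z rule: Mx.tensor_induct) (auto simp: carrier_H)

lemma PM_induct [consumes 1, case_names pure mult]:
  assumes "z \<in> carrier PM.T"
    and "\<And>f m. Q (pt act f m)"
    and "\<And>x y. x \<in> carrier PM.T \<Longrightarrow> y \<in> carrier PM.T \<Longrightarrow> Q x \<Longrightarrow> Q y \<Longrightarrow> Q (x \<otimes>\<^bsub>PM.T\<^esub> y)"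
  shows "Q z"
  using assms by (induction z rule: PM.tensor_induct) (auto simp: pt_eq)

lemma Mx_pure_closed: "Mx.pure (hcls u v a) m \<in> carrier Mx.T"
  by (rule Mx.pure_closed[OF hcls_closed])

lemma J_mult: "z \<in> carrier Mx.T \<Longrightarrow> J (a * b) z = J a (J b z)"
proof (induction z rule: Mx_induct)
  case (pure c m)
  show ?case by (simp add: J_pure mult.assoc)
next
  case (mult x y)
  then show ?case
    using hom_mult[OF J_hom] hom_in_carrier[OF J_hom] by simp
qed

lemma J_add: "z \<in> carrier Mx.T \<Longrightarrow> J (a + b) z = J a z \<otimes>\<^bsub>Mx.T\<^esub> J b z"
proof (induction z rule: Mx_induct)
  case (pure c m)
  show ?case
    using Mx.pure_add_left[OF hcls_closed[of u v "a * c"] hcls_closed[of u v "b * c"], of m]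
    by (simp add: J_pure distrib_right hcls_simps)
next
  case (mult x y)
  then show ?case
    using hom_mult[OF J_hom] hom_in_carrier[OF J_hom] by (simp add: Mx.T.m_ac)
qed


subsection \<open>The polynomials span the induced module\<close>

definition span :: "('n hgen free_alg set \<times> 'm \<Rightarrow>\<^sub>0 int) set set" where
  "span = ident u v act ` carrier PM.T"

lemma span_pure: "Mx.pure (hcls u v (yev f)) m \<in> span"
  unfolding span_def ident_pt[symmetric] by (intro imageI pt_closed)

lemma span_mult: "x \<in> span \<Longrightarrow> y \<in> span \<Longrightarrow> x \<otimes>\<^bsub>Mx.T\<^esub> y \<in> span"
  unfolding span_def by (auto simp flip: hom_mult[OF ident_hom])

lemma span_closed: "x \<in> span \<Longrightarrow> x \<in> carrier Mx.T"
  unfolding span_def using hom_in_carrier[OF ident_hom] by auto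

lemma span_induct [consumes 1, case_names pure mult]:
  assumes "z \<in> span"
    and "\<And>f m. Q (Mx.pure (hcls u v (yev f)) m)"
    and "\<And>x y. x \<in> span \<Longrightarrow> y \<in> span \<Longrightarrow> Q x \<Longrightarrow> Q y \<Longrightarrow> Q (x \<otimes>\<^bsub>Mx.T\<^esub> y)"
  shows "Q z"
proof -
  obtain p where p: "p \<in> carrier PM.T" and z: "z = ident u v act p"
    using assms(1) by (auto simp: span_def)
  show ?thesis
    unfolding z using p
    by (induction p rule: PM_induct) (auto simp: ident_pt assms hom_mult[OF ident_hom] span_def)
qed

text \<open>Defined on the free algebra, where elements preserving the span are closed under sums
  and products, so that checking scalars and generators suffices.\<close>

definition stab :: "'n hgen free_alg \<Rightarrow> bool" where
  "stab a \<longleftrightarrow> (\<forall>z\<in>span. J a z \<in> span)"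

lemma stabI:
  assumes "\<And>f m. Mx.pure (hcls u v (a * yev f)) m \<in> span"
  shows "stab a"
  unfolding stab_def
proof
  fix z assume "z \<in> span"
  then show "J a z \<in> span"
    by (induction z rule: span_induct)
      (auto simp: J_pure assms hom_mult[OF J_hom] span_closed span_mult)
qed

lemma stab_add: "stab a \<Longrightarrow> stab b \<Longrightarrow> stab (a + b)"
  by (auto simp: stab_def J_add span_closed span_mult)

lemma stab_mult: "stab a \<Longrightarrow> stab b \<Longrightarrow> stab (a * b)"
  by (auto simp: stab_def J_mult span_closed)

lemma stab_scal: "stab (scal a)"
  by (rule stabI) (metis span_pure yev_scale)

lemma stab_one: "stab 1"
  using stab_scal[of 1] by (simp add: scal_simps)

lemma stab_uminus: "stab a \<Longrightarrow> stab (- a)"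
proof -
  have "(- 1 :: 'n hgen free_alg) = scal (- 1)"
    by (metis add.inverse_unique scal_simps(1,3) scal_def single_zero add.right_inverse)
  then have "stab (- 1)" by (simp only: stab_scal)
  then show "stab a \<Longrightarrow> stab (- a)"
    using stab_mult[of "- 1" a] by simp
qed

lemma stab_diff: "stab a \<Longrightarrow> stab b \<Longrightarrow> stab (a - b)"
  using stab_add[of a "- b"] stab_uminus[of b] by simp

lemma stab_sum: "(\<And>k. k \<in> A \<Longrightarrow> stab (h k)) \<Longrightarrow> stab (sum h A)"
proof (induction A rule: infinite_finite_induct)
qed (auto intro: stab_add simp: stab_scal[of 0, unfolded scal_def, simplified])

lemma stab_Y: "stab (hy j)"
  by (rule stabI) (metis span_pure hcls_yev_var)

lemma pure_Hx:
  assumes "hcls u v b \<in> Hx_set u v"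
  shows "Mx.pure (hcls u v (a * b)) m = Mx.pure (hcls u v a) (\<rho> (hcls u v b) m)"
  using Mx.pure_balanced[OF hcls_closed assms] by (simp add: hcls_simps)

lemma stab_C: "stab (hc j)"
  by (rule stabI) (simp only: hcls_C_yev pure_Hx[OF Hx_gens(2)] span_pure)

lemma stab_G: "stab (hg w)"
  by (rule stabI) (simp only: hcls_G_yev pure_Hx[OF Hx_gens(3)] span_pure)

text \<open>For spanning, the commutator of y_j and x_i matters only as an expression in scalars,
  c_i and w, all of which preserve the span; this is all that the element a retains.\<close>

lemma hcls_YX:
  obtains a where "stab a" "hcls u v (hx i * hy j) = hcls u v (hy j * hx i + a)"
proof -
  note stab = stab_add stab_diff stab_uminus stab_mult stab_scal stab_one stab_C stab_G stab_sum
  have "\<exists>b. stab b \<and> hcls u v (hy j * hx i - hx i * hy j) = hcls u v b"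
  proof (cases "i = j")
    case True
    have "hcls u v (hy i * hx i - hx i * hy i) = hcls u v (- scal u * (\<Sum>k\<in>UNIV - {i}.
      (1 + hc k * hc i) * hg (swp k i) + (1 - hc k * hc i) * hg (swp_neg k i))
      - scal (complex_of_real (sqrt 2) * v) * hg (neg_at i))"
      by (rule hcls_rel) (unfold H_rels_def, blast)
    moreover have "stab (- scal u * (\<Sum>k\<in>UNIV - {i}.
      (1 + hc k * hc i) * hg (swp k i) + (1 - hc k * hc i) * hg (swp_neg k i))
      - scal (complex_of_real (sqrt 2) * v) * hg (neg_at i))"
      by (intro stab)
    ultimately show ?thesis using True by blast
  next
    case False
    have "hcls u v (hy j * hx i - hx i * hy j) = hcls u v
      (scal u * ((1 + hc j * hc i) * hg (swp i j) - (1 - hc j * hc i) * hg (swp_neg i j)))"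
      by (rule hcls_rel) (use False in \<open>unfold H_rels_def, blast\<close>)
    moreover have "stab (scal u * ((1 + hc j * hc i) * hg (swp i j) - (1 - hc j * hc i) * hg (swp_neg i j)))"
      by (intro stab)
    ultimately show ?thesis by blast
  qed
  then obtain b where b: "stab b" "hcls u v (hy j * hx i - hx i * hy j) = hcls u v b" by blast
  have "hcls u v (- (hy j * hx i - hx i * hy j)) = hcls u v (- b)"
    by (simp only: b(2) flip: hcls_simps(3))
  from hcls_add[OF refl this, of "hy j * hx i"]
  have "hcls u v (hx i * hy j) = hcls u v (hy j * hx i + - b)" by simp
  then show thesis using that b(1) stab_uminus by blast
qed

text \<open>On constants x_i crosses the tensor sign and kills M. For y_j f it is moved behind y_j:
  y_j (x_i f) lies in the span by induction, and the correction term preserves the span.\<close>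

lemma stab_X: "stab (hx i)"
proof (rule stabI)
  fix f m
  show "Mx.pure (hcls u v (hx i * yev f)) m \<in> span"
  proof (induction f rule: ypoly_induct)
    case (const a)
    have "Mx.pure (hcls u v (hx i * yev (yconst a))) m = \<one>\<^bsub>Mx.T\<^esub>"
      using scal_commute[of a "hx i"]
      by (simp add: yev_const pure_Hx[OF Hx_gens(4)] rho_values Mx.pure_zero_right[OF hcls_closed] flip: scal_commute)
    moreover have "\<one>\<^bsub>Mx.T\<^esub> = Mx.pure (hcls u v (yev 1)) 0"
      by (simp add: Mx.pure_zero_right[OF hcls_closed])
    ultimately show ?case using span_pure by simp
  next
    case (var j f)
    obtain a where a: "stab a" "hcls u v (hx i * hy j) = hcls u v (hy j * hx i + a)"
      by (rule hcls_YX)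
    have "hcls u v (hx i * yev (yvar j * f)) = hcls u v (hx i * hy j * yev f)"
      unfolding mult.assoc by (intro hcls_mult[OF refl] hcls_yev_var)
    also have "\<dots> = hcls u v ((hy j * hx i + a) * yev f)"
      by (rule hcls_mult[OF a(2) refl])
    also have "\<dots> = hcls u v (hy j * (hx i * yev f)) \<oplus>\<^bsub>H_alg u v\<^esub> hcls u v (a * yev f)"
      by (simp add: hcls_simps distrib_right mult.assoc)
    finally have "Mx.pure (hcls u v (hx i * yev (yvar j * f))) m =
        J (hy j) (Mx.pure (hcls u v (hx i * yev f)) m) \<otimes>\<^bsub>Mx.T\<^esub> J a (Mx.pure (hcls u v (yev f)) m)"
      by (simp add: Mx.pure_add_left[OF hcls_closed hcls_closed] J_pure)
    then show ?case
      using var a(1) stab_Y[of j] span_pure[of f m] by (auto simp: stab_def intro: span_mult)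
  next
    case (add f g)
    have "Mx.pure (hcls u v (hx i * yev (f + g))) m =
        Mx.pure (hcls u v (hx i * yev f)) m \<otimes>\<^bsub>Mx.T\<^esub> Mx.pure (hcls u v (hx i * yev g)) m"
      using Mx.pure_add_left[OF hcls_closed hcls_closed] by (simp add: yev_add distrib_left hcls_simps)
    then show ?case using add by (simp add: span_mult)
  qed
qed

lemma stab_all: "stab a"
proof (induction a rule: free_alg_induct)
  case (gen g)
  show ?case
    by (cases g; simp add: stab_X stab_Y) (metis kgen.exhaust stab_C stab_G)
qed (auto intro: stab_scal stab_add stab_mult)

lemma span_eq: "span = carrier Mx.T"
proof
  show "carrier Mx.T \<subseteq> span"
  proof
    fix z assume "z \<in> carrier Mx.T"
    then show "z \<in> span"
    proof (induction z rule: Mx_induct)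
      case (pure a m)
      have "Mx.pure (hcls u v (1 :: 'n hgen free_alg)) m \<in> span"
        using span_pure[of 1 m] by (simp add: yev_one)
      then have "J a (Mx.pure (hcls u v 1) m) \<in> span"
        using stab_all[of a] by (simp add: stab_def)
      then show ?case by (simp add: J_pure)
    qed (rule span_mult)
  qed
qed (auto intro: span_closed)


subsection \<open>Comparison with the Dunkl representation\<close>

text \<open>The map is balanced over \<open>Hx_set\<close> by \<open>hact_Hx_act\<close>, so it
  descends to M_x.\<close>

lemma Theta_exists:
  "\<exists>h \<in> hom Mx.T add_grp. \<forall>a m. h (Mx.pure (hcls u v a) m) = app (rep a) (tm 1 m)"
proof (rule Mx.tensor_universal[OF comm_group_add_grp, of "\<lambda>h m. app (hact h) (tm 1 m)"])
  fix h s :: "'n hgen free_alg set" and m assume "h \<in> carrier (H_alg u v)" "s \<in> Hx_set u v"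
  then show "app (hact (h \<otimes>\<^bsub>H_alg u v\<^esub> s)) (tm 1 m) = app (hact h) (tm 1 (\<rho> s m))"
    by (simp add: hact_simps Hx_closed hact_Hx_act)
next
  fix h assume "h \<in> hom Mx.T add_grp"
    and "\<And>a m. a \<in> carrier (H_alg u v) \<Longrightarrow> h (Mx.pure a m) = app (hact a) (tm 1 m)"
  then show ?thesis
    by (intro bexI[of _ h]) (simp_all add: hcls_closed)
qed (simp_all add: hact_simps tm_add_right)

lemma Lambda_exists: "\<exists>h \<in> hom PM.T add_grp. \<forall>f m. h (pt act f m) = tm f m"
  by (rule PM.tensor_universal[OF comm_group_add_grp, of tm])
    (auto simp: tm_add_left tm_add_right tm_scale const_act_yconst mult.commute[of _ "yconst _"] pt_eq)

definition "\<Theta> = (SOME h. h \<in> hom Mx.T add_grp \<and> (\<forall>a m. h (Mx.pure (hcls u v a) m) = app (rep a) (tm 1 m)))"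
definition "\<Lambda> = (SOME h. h \<in> hom PM.T add_grp \<and> (\<forall>f m. h (pt act f m) = tm f m))"

lemma Theta: "\<Theta> \<in> hom Mx.T add_grp" "\<Theta> (Mx.pure (hcls u v a) m) = app (rep a) (tm 1 m)"
  using someI_ex[OF Theta_exists[unfolded Bex_def]] by (auto simp: \<Theta>_def)

lemma Lambda: "\<Lambda> \<in> hom PM.T add_grp" "\<Lambda> (pt act f m) = tm f m"
  using someI_ex[OF Lambda_exists[unfolded Bex_def]] by (auto simp: \<Lambda>_def)

lemma rep_yev: "app (rep (yev f)) (tm 1 m) = tm f m"
proof (induction f rule: ypoly_induct)
  case (const a)
  show ?case using tm_scale[of a 1 m] by (simp add: yev_const rep_tm_one app_kop)
next
  case (var j f)
  have "rep (yev (yvar j * f)) = rep (hy j * yev f)"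
    using hcls_yev_var[of u v j f] by (metis hact_hcls)
  then show ?case by (simp add: rep.hom_mult var) (simp add: Y_def oper_tm ylin_intros)
qed (simp add: yev_add rep.hom_add tm_add_left)

lemma Theta_ident: "p \<in> carrier PM.T \<Longrightarrow> \<Theta> (ident u v act p) = \<Lambda> p"
proof (induction p rule: PM_induct)
  case (pure f m)
  show ?case by (simp add: ident_pt Theta Lambda rep_yev)
next
  case (mult x y)
  then show ?case
    using hom_in_carrier[OF ident_hom] by (simp add: hom_mult[OF ident_hom] hom_mult[OF Theta(1)] hom_mult[OF Lambda(1)])
qed

text \<open>Rebuilds a tensor from its coefficients and thereby inverts \<open>\<Lambda>\<close>.
  The monomials form an infinite index set, on which \<open>finprod\<close> would return the unit;
  \<open>gfinprod\<close> restricts to the finite support.\<close>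

definition Inv :: "(('n \<Rightarrow>\<^sub>0 nat) \<Rightarrow>\<^sub>0 'm) \<Rightarrow> ('n ypoly \<times> 'm \<Rightarrow>\<^sub>0 int) set" where
  "Inv p = gfinprod PM.T (\<lambda>\<alpha>. pt act (Poly_Mapping.single \<alpha> 1) (Poly_Mapping.lookup p \<alpha>)) UNIV"

lemma pt_add_right: "pt act f (m + m') = pt act f m \<otimes>\<^bsub>PM.T\<^esub> pt act f m'"
  and pt_add_left: "pt act (f + g) m = pt act f m \<otimes>\<^bsub>PM.T\<^esub> pt act g m"
  and pt_zero: "pt act f 0 = \<one>\<^bsub>PM.T\<^esub>"
  using PM.pure_add_right[of f m m'] PM.pure_add_left[of f g m] PM.pure_zero_right[of f]
  by (simp_all add: pt_eq)

lemma Inv_add: "Inv (p + q) = Inv p \<otimes>\<^bsub>PM.T\<^esub> Inv q"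
proof -
  have fin: "finite {\<alpha> \<in> UNIV. pt act (Poly_Mapping.single \<alpha> 1) (Poly_Mapping.lookup p \<alpha>) \<noteq> \<one>\<^bsub>PM.T\<^esub>}" for p
    by (rule finite_subset[OF _ finite_keys[of p]]) (auto simp: in_keys_iff pt_zero)
  show ?thesis
    unfolding Inv_def lookup_add pt_add_right
    by (rule PM.T.gfinprod_distrib[OF fin fin]) (auto intro: pt_closed)
qed

lemma Inv_single: "Inv (Poly_Mapping.single \<alpha> m) = pt act (Poly_Mapping.single \<alpha> 1) m"
proof -
  have "Inv (Poly_Mapping.single \<alpha> m) =
      gfinprod PM.T (\<lambda>\<beta>. pt act (Poly_Mapping.single \<beta> 1) (Poly_Mapping.lookup (Poly_Mapping.single \<alpha> m) \<beta>)) {\<alpha>}"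
    unfolding Inv_def
    by (rule PM.T.gfinprod_mono_neutral_cong_right)
      (auto simp: lookup_single_not_eq pt_zero intro: pt_closed)
  then show ?thesis by (simp add: PM.T.gfinprod_eq_finprod pt_closed)
qed

lemma Inv_tm: "Inv (tm f m) = pt act f m"
proof (induction f rule: poly_mapping_add_induct)
  case (single \<alpha> a)
  have "pt act (Poly_Mapping.single \<alpha> 1) (app (kop (scal a)) m) = pt act (Poly_Mapping.single \<alpha> a) m"
    unfolding pt_scale[symmetric] by (simp add: yconst_def mult_single)
  then show ?case by (simp add: tm_single Inv_single)
qed (simp add: tm_add_left Inv_add pt_add_left)

lemma Inv_Lambda: "p \<in> carrier PM.T \<Longrightarrow> Inv (\<Lambda> p) = p"
  by (induction p rule: PM_induct) (simp_all add: Lambda Inv_tm hom_mult[OF Lambda(1)] Inv_add)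

lemma ident_inj: "inj_on (ident u v act) (carrier PM.T)"
  by (rule inj_onI) (metis Theta_ident Inv_Lambda)

lemma Lambda_psmult: "z \<in> carrier PM.T \<Longrightarrow> \<Lambda> (psmult act a z) = app (Sc a) (\<Lambda> z)"
proof (induction z rule: PM_induct)
  case (pure f m)
  show ?case by (simp add: psmult_pt Lambda tm_scale) (simp add: Sc_def oper_tm ylin_id)
next
  case (mult x y)
  then show ?case
    using hom_in_carrier[OF psmult_hom] by (simp add: hom_mult[OF psmult_hom] hom_mult[OF Lambda(1)])
qed

lemma Lambda_finprod:
  "finite A \<Longrightarrow> (\<And>k. k \<in> A \<Longrightarrow> g k \<in> carrier PM.T) \<Longrightarrow> \<Lambda> (finprod PM.T g A) = (\<Sum>k\<in>A. \<Lambda> (g k))"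
proof (induction A rule: finite_induct)
  case empty
  have "\<Lambda> \<one>\<^bsub>PM.T\<^esub> = 0" using Lambda(2)[of 0 0] by (simp add: pt_zero)
  then show ?case by simp
next
  case (insert k A)
  then show ?case
    by (subst PM.T.finprod_insert) (auto simp: hom_mult[OF Lambda(1)] PM.T.finprod_closed)
qed

text \<open>As \<open>ident\<close> is onto, the product of a and f(y), tensored with m, is the
  image of some p. Applying \<open>\<Theta>\<close> gives \<open>\<Lambda> p = \<Lambda> z\<close>,
  hence p = z. A proposed value of the action can thus be verified entirely in the model.\<close>

lemma PM_actI:
  assumes "z \<in> carrier PM.T" and "\<Lambda> z = app (rep a) (tm f m)"
  shows "PM_act u v act (hcls u v a) (pt act f m) = z"
proof -
  let ?w = "Mx.pure (hcls u v (a * yev f)) m"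
  have "?w \<in> span"
    unfolding span_eq by (rule Mx_pure_closed)
  then obtain p where p: "p \<in> carrier PM.T" "?w = ident u v act p"
    by (auto simp: span_def)
  have "\<Lambda> p = app (rep (a * yev f)) (tm 1 m)"
    using Theta_ident[OF p(1)] p(2) Theta(2)[of "a * yev f" m] by simp
  also have "\<dots> = \<Lambda> z"
    by (simp add: rep.hom_mult rep_yev assms)
  finally have "p = z"
    using Inv_Lambda p(1) assms(1) by metis
  then show ?thesis
    unfolding PM_act_def PM_eq ident_pt J_pure p(2)
    using the_inv_into_f_f[OF ident_inj] assms(1) by simp
qed

end

theorem theorem4p13:
  fixes u v :: complex
    and act :: "'n::{finite,linorder} kgen free_alg set \<Rightarrow> 'm::ab_group_add \<Rightarrow> 'm"
    and f :: "'n ypoly" and m :: 'm and i :: 'n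
  assumes "CARD('n) \<ge> 2"
    and "left_module K_alg act"
  shows "PM_act u v act (hcls u v (hx i)) (pt act f m) =
      psmult act u
        (finprod (PM act)
          (\<lambda>k. pt act (yquot (f - yact (swp k i) f) (yvar i - yvar k))
                 (act (kcls ((1 + kc k * kc i) * kg (swp k i))) m))
          (UNIV - {i}))
      \<otimes>\<^bsub>PM act\<^esub>
      psmult act u
        (finprod (PM act)
          (\<lambda>k. pt act (yquot (f - yact (swp_neg k i) f) (yvar i + yvar k))
                 (act (kcls ((1 - kc k * kc i) * kg (swp_neg k i))) m))
          (UNIV - {i}))
      \<otimes>\<^bsub>PM act\<^esub>
      psmult act (complex_of_real (sqrt 2) * v)
        (pt act (yquot (f - yact (neg_at i) f) (2 * yvar i))
           (act (kcls (kg (neg_at i))) m))"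
proof -
  interpret K_module act u v
    by (rule K_module.intro) (rule assms(2))
  \<comment> \<open>The quotients of the formula are the divided differences of the two kinds of
    swaps, and the elements acting on m are \<open>ke\<close>.\<close>
  have E: "pt act (yquot (f - yact (swp k i) f) (yvar i - yvar k)) (act (kcls ((1 + kc k * kc i) * kg (swp k i))) m) =
      pt act (dd (sw True k i) (rt True k i) f) (app (kop (ke True k i)) m)"
    "pt act (yquot (f - yact (swp_neg k i) f) (yvar i + yvar k)) (act (kcls ((1 - kc k * kc i) * kg (swp_neg k i))) m) =
      pt act (dd (sw False k i) (rt False k i) f) (app (kop (ke False k i)) m)" for k
    by (simp_all add: dd_def sw_def rt_def ke_def app_kop)
  have F: "pt act (yquot (f - yact (neg_at i) f) (2 * yvar i)) (act (kcls (kg (neg_at i))) m) =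
      pt act (dd (neg_at i) (2 * yvar i) f) (app (kop (kg (neg_at i))) m)"
    by (simp add: dd_def app_kop)
  have prod: "finprod PM.T (\<lambda>k. pt act (g k) (h k)) A \<in> carrier PM.T" for g h and A :: "'n set"
    by (rule PM.T.finprod_closed) (auto intro: pt_closed)
  note closed = hom_in_carrier[OF psmult_hom] prod pt_closed
  show ?thesis
    unfolding E F PM_eq
  proof (rule PM_actI)
    \<comment> \<open>The image of each summand in the model is a summand of \<open>D i\<close>
      applied to f (x) m. The formula sums the two kinds of swaps separately, \<open>D\<close>
      jointly, which \<open>sum.distrib\<close> reconciles below.\<close>
    have E_tm: "(\<Sum>k\<in>UNIV - {i}. tm (dd (sw b k i) (rt b k i) f) (app (kop (ke b k i)) m)) =
        (\<Sum>k\<in>UNIV - {i}. app (E b k i) (tm f m))" for b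
      by (rule sum.cong) (simp_all add: E_def oper_tm ylin_intros)
    have F_tm: "tm (dd (neg_at i) (2 * yvar i) f) (app (kop (kg (neg_at i))) m) = app (F i) (tm f m)"
      by (simp add: F_def oper_tm ylin_intros)
    show "\<Lambda> (psmult act u (finprod PM.T (\<lambda>k. pt act (dd (sw True k i) (rt True k i) f) (app (kop (ke True k i)) m)) (UNIV - {i}))
        \<otimes>\<^bsub>PM.T\<^esub> psmult act u (finprod PM.T (\<lambda>k. pt act (dd (sw False k i) (rt False k i) f) (app (kop (ke False k i)) m)) (UNIV - {i}))
        \<otimes>\<^bsub>PM.T\<^esub> psmult act (complex_of_real (sqrt 2) * v)
          (pt act (dd (neg_at i) (2 * yvar i) f) (app (kop (kg (neg_at i))) m))) = app (rep (hx i)) (tm f m)"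
      by (simp add: hom_mult[OF Lambda(1)] closed Lambda_psmult Lambda_finprod Lambda E_tm F_tm pt_closed
          D_def app_sum_endo sum.distrib)
  qed (intro PM.T.m_closed closed)
qed

end
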